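(* Consider the stationary decision model with infinite planning horizon and zero terminal cost described in the context and assume the following. (M1) The state space is $E=\mathbb R$. (M2) The sets $D(x)$ are compact, and $\mathbb R\ni x\mapsto D(x)$ is upper semicontinuous (if $x_k\to x$ and $a_k\in D(x_k)$, then $(a_k)$ has an accumulation point in $D(x)$) and decreasing, i.e. $D(x)\supseteq D(y)$ for $x\le y$. (M3) For every $z\in\mathcal Z$ the transition function $T(x,a,z)$ is lower semicontinuous in $(x,a)$ and increasing in $x$. (M4) The one-stage cost function $c(x,a,x')$ is lower semicontinuous in $(x,a,x')$ and increasing in $(x,x')$. (B$^-$) There exist constants $\underline b\le0$, $\bar\epsilon\ge0$, $\alpha\ge1$ with $\bar\epsilon-\underline b=1$ and an increasing function $\bar b:\mathbb R\to[\bar\epsilon,\infty)$ such that for all $(x,a)\in D$: $c(x,a,T(x,a,Z))\ge\underline b$ $\mathbb P$-a.s., $\rho\big(c(x,a,T(x,a,Z))\big)\le\bar b(x)$ and $\rho\big(\bar b(T(x,a,Z))\big)\le\alpha\bar b(x)$. (Integrability) Put $b=\bar b-\underline b:\mathbb R\to[1,\infty)$. For all $(\bar x,\bar a)\in D$ there exist $\epsilon>0$ and measurable $\Theta_1^{\bar x,\bar a},\Theta_2^{\bar x,\bar a}:\mathcal Z\to\mathbb R_+$ with $\Theta_1^{\bar x,\bar a}(Z),\Theta_2^{\bar x,\bar a}(Z)\in L^p$ and $|c(x,a,T(x,a,z))|\le\Theta_1^{\bar x,\bar a}(z)$, $b(T(x,a,z))\le\Theta_2^{\bar x,\bar a}(z)$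 for all $z\in\mathcal Z$ and all $(x,a)\in D$ in the closed ball of radius $\epsilon$ around $(\bar x,\bar a)$ (w.r.t. a product metric on $\mathbb R\times A$). (Risk measure) $\rho:L^p\to\bar{\mathbb R}$ is a law invariant, comonotonic additive and positive homogeneous monetary risk measure with the Fatou property. (Discounting) $\alpha\beta<1$. Let $\underline{\mathbf b}=\frac1{1-\alpha\beta}\underline b$, $\bar{\mathbf b}=\frac1{1-\alpha\beta}\bar b$, and let $I$ be the set of lower semicontinuous increasing functions $v:\mathbb R\to\mathbb R$ with $\underline{\mathbf b}\le v\le\bar{\mathbf b}$ pointwise. Then: a) For every Markov policy $\pi\in\Pi^M$ the sequence $(J_{N\pi})_{N\in\mathbb N}$ converges pointwise, and the limit $J_{\infty\pi}$ satisfies $\underline{\mathbf b}\le J_{\infty\pi}\le\bar{\mathbf b}$. b) The Bellman operator $\mathcal T$ is a contraction on $I$ with modulus $\alpha\beta\in(0,1)$ with respect to the norm $\|v\|_b=\sup_{x\in\mathbb R}|v(x)|/b(x)$, and the limit value function $J=\lim_{N\to\infty}J_N$ is the unique fixed point of $\mathcal T$ in $I$. c) There exists a Markov decision rule $d^*$ such that $\mathcal T_{d^*}J=\mathcal TJ$; each stationary policy $\pi^*=(d^*,d^*,\dots)$ induced by such a Markov decision rule is optimal, i.e. $J_{\infty\pi^*}=J_\infty=\inf_{\pi\in\Pi^M}J_{\infty\pi}$; and $J_\infty=J$.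
   Context: "Increasing" and "decreasing" are meant in the weak sense. Risk measures. Fix a probability space $(\Omega,\mathcal A,\mathbb P)$ and $p\in[1,\infty)$; $L^p=L^p(\Omega,\mathcal A,\mathbb P)$. A risk measure is a map $\rho:L^p\to\bar{\mathbb R}=[-\infty,\infty]$. Monetary: monotone ($X\le Y\Rightarrow\rho(X)\le\rho(Y)$) and translation invariant ($\rho(X+m)=\rho(X)+m$, $m\in\mathbb R$). Positive homogeneous: $\rho(\lambda X)=\lambda\rho(X)$ for $\lambda\in\mathbb R_+$ (so $\rho(0)=0$). Comonotonic additive: $\rho(X+Y)=\rho(X)+\rho(Y)$ for all comonotonic $X,Y$ (e.g. increasing functions of a common real random variable are comonotonic). Law invariant: $\rho(X)=\rho(Y)$ whenever $X,Y$ have the same distribution. Fatou property: for $(X_n)\subseteq L^p$ with $|X_n|\le Y$ a.s., $Y\in L^p$, and $X_n\to X\in L^p$ a.s., $\liminf_n\rho(X_n)\ge\rho(X)$. Stationary decision model. Action space $A$ is a Borel space (Borel subset of a Polish space), state space $E=\mathbb R$; $D\subseteq E\times A$ is measurable and contains the graph of a measurable map $E\to A$; $D(x)=\{a:(x,a)\in D\}$; $T:D\times\mathcal Z\to E$ is a measurable transition function; the disturbances are i.i.d. random elements on $(\Omega,\mathcal A,\mathbb P)$ with values in a measurable space $(\mathcal Z,\mathfrak Z)$, with representative $Z$; $c:D\times E\to\mathbb R$ is the one-stage cost; $\beta\in(0,1]$ is the discount factor; terminal cost is zero. A Markov decision rule is a measurable $d:E\to A$ with $d(x)\in D(x)$;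 $\Pi^M$ is the set of Markov policies $\pi=(d_0,d_1,\dots)$. Operators. For measurable $v$ with $|v|\le\lambda b$ for some $\lambda\in\mathbb R_+$: $\mathcal T_dv(x)=\rho\big(c(x,d(x),T(x,d(x),Z))+\beta v(T(x,d(x),Z))\big)$, $\mathcal Tv(x)=\inf_{a\in D(x)}\rho\big(c(x,a,T(x,a,Z))+\beta v(T(x,a,Z))\big)$. Values. $J_{N\pi}=\mathcal T_{d_0}\circ\dots\circ\mathcal T_{d_{N-1}}0$ for $N\in\mathbb N$, $J_{0\pi}=0$; $J_N=\inf_{\pi\in\Pi^M}J_{N\pi}$; $J_{\infty\pi}=\lim_NJ_{N\pi}$; $J_\infty=\inf_{\pi\in\Pi^M}J_{\infty\pi}$; $J=\lim_NJ_N$ (pointwise limits; they exist under the stated assumptions). It is assumed throughout that $\rho$ is such that all policy values $J_{N\pi}$ are measurable. *)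

theory Defs
  imports "HOL-Probability.Probability"
begin

definition lsc_on :: "'x::topological_space set \<Rightarrow> ('x \<Rightarrow> real) \<Rightarrow> bool" where
  "lsc_on S f \<longleftrightarrow> (\<forall>x\<in>S. \<forall>y<f x. eventually (\<lambda>x'. y < f x') (at x within S))"

text \<open>Risk measures are functions on representatives. Only their values on \<open>Lp_space M p\<close> matter,
  and \<open>monetary\<close> forces them to agree on functions that are equal almost surely.\<close>

definition Lp_space :: "'w measure \<Rightarrow> real \<Rightarrow> ('w \<Rightarrow> real) set" where
  "Lp_space M p = {X \<in> borel_measurable M. integrable M (\<lambda>w. \<bar>X w\<bar> powr p)}"

definition monetary :: "'w measure \<Rightarrow> real \<Rightarrow> (('w \<Rightarrow> real) \<Rightarrow> ereal) \<Rightarrow> bool" where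
  "monetary M p \<rho> \<longleftrightarrow>
     (\<forall>X\<in>Lp_space M p. \<forall>Y\<in>Lp_space M p. (AE w in M. X w \<le> Y w) \<longrightarrow> \<rho> X \<le> \<rho> Y) \<and>
     (\<forall>X\<in>Lp_space M p. \<forall>m::real. \<rho> (\<lambda>w. X w + m) = \<rho> X + ereal m)"

definition pos_homogeneous :: "'w measure \<Rightarrow> real \<Rightarrow> (('w \<Rightarrow> real) \<Rightarrow> ereal) \<Rightarrow> bool" where
  "pos_homogeneous M p \<rho> \<longleftrightarrow>
     (\<forall>X\<in>Lp_space M p. \<forall>l::real. 0 \<le> l \<longrightarrow> \<rho> (\<lambda>w. l * X w) = ereal l * \<rho> X)"

definition comonotonic :: "'w measure \<Rightarrow> ('w \<Rightarrow> real) \<Rightarrow> ('w \<Rightarrow> real) \<Rightarrow> bool" where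
  "comonotonic M X Y \<longleftrightarrow>
     (AE (w, w') in M \<Otimes>\<^sub>M M. 0 \<le> (X w - X w') * (Y w - Y w'))"

text \<open>Additivity is required only where the sum on the right is defined, i.e. is not of the form
  \<open>\<infinity> - \<infinity>\<close> (to which the library's addition would assign the value \<open>\<infinity>\<close>).\<close>

definition comonotonic_additive :: "'w measure \<Rightarrow> real \<Rightarrow> (('w \<Rightarrow> real) \<Rightarrow> ereal) \<Rightarrow> bool" where
  "comonotonic_additive M p \<rho> \<longleftrightarrow>
     (\<forall>X\<in>Lp_space M p. \<forall>Y\<in>Lp_space M p.
        comonotonic M X Y \<and> {\<rho> X, \<rho> Y} \<noteq> {-\<infinity>, \<infinity>} \<longrightarrow> \<rho> (\<lambda>w. X w + Y w) = \<rho> X + \<rho> Y)"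

definition law_invariant :: "'w measure \<Rightarrow> real \<Rightarrow> (('w \<Rightarrow> real) \<Rightarrow> ereal) \<Rightarrow> bool" where
  "law_invariant M p \<rho> \<longleftrightarrow>
     (\<forall>X\<in>Lp_space M p. \<forall>Y\<in>Lp_space M p. distr M borel X = distr M borel Y \<longrightarrow> \<rho> X = \<rho> Y)"

definition fatou_property :: "'w measure \<Rightarrow> real \<Rightarrow> (('w \<Rightarrow> real) \<Rightarrow> ereal) \<Rightarrow> bool" where
  "fatou_property M p \<rho> \<longleftrightarrow>
     (\<forall>Xs X Y. (\<forall>n::nat. Xs n \<in> Lp_space M p) \<and> X \<in> Lp_space M p \<and> Y \<in> Lp_space M p \<and>
        (\<forall>n. AE w in M. \<bar>Xs n w\<bar> \<le> Y w) \<and> (AE w in M. (\<lambda>n. Xs n w) \<longlonglongrightarrow> X w)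
        \<longrightarrow> \<rho> X \<le> liminf (\<lambda>n. \<rho> (Xs n)))"

definition decision_rules ::
    "'a::topological_space set \<Rightarrow> (real \<times> 'a) set \<Rightarrow> (real \<Rightarrow> 'a) set" where
  "decision_rules A D = {d \<in> borel \<rightarrow>\<^sub>M restrict_space borel A. \<forall>x. (x, d x) \<in> D}"

definition markov_policies ::
    "'a::topological_space set \<Rightarrow> (real \<times> 'a) set \<Rightarrow> (nat \<Rightarrow> real \<Rightarrow> 'a) set" where
  "markov_policies A D = {\<pi>. \<forall>n. \<pi> n \<in> decision_rules A D}"

text \<open>Since \<open>\<rho>\<close> is extended real valued, so are the operators and value functions below. They are
  meant to be applied to real-valued arguments only: \<open>real_of_ereal\<close> just undoes the embedding,
  and its convention for infinite values is not intended to play a role.\<close>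

definition stage_risk ::
    "(('w \<Rightarrow> real) \<Rightarrow> ereal) \<Rightarrow> (real \<Rightarrow> 'a \<Rightarrow> 'z \<Rightarrow> real) \<Rightarrow> ('w \<Rightarrow> 'z) \<Rightarrow>
     (real \<Rightarrow> 'a \<Rightarrow> real \<Rightarrow> real) \<Rightarrow> real \<Rightarrow> (real \<Rightarrow> ereal) \<Rightarrow> real \<Rightarrow> 'a \<Rightarrow> ereal" where
  "stage_risk \<rho> T Z c \<beta> v x a =
     \<rho> (\<lambda>w. c x a (T x a (Z w)) + \<beta> * real_of_ereal (v (T x a (Z w))))"

definition policy_op ::
    "(('w \<Rightarrow> real) \<Rightarrow> ereal) \<Rightarrow> (real \<Rightarrow> 'a \<Rightarrow> 'z \<Rightarrow> real) \<Rightarrow> ('w \<Rightarrow> 'z) \<Rightarrow>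
     (real \<Rightarrow> 'a \<Rightarrow> real \<Rightarrow> real) \<Rightarrow> real \<Rightarrow> (real \<Rightarrow> 'a) \<Rightarrow> (real \<Rightarrow> ereal) \<Rightarrow> real \<Rightarrow> ereal" where
  "policy_op \<rho> T Z c \<beta> d v x = stage_risk \<rho> T Z c \<beta> v x (d x)"

definition bellman_op ::
    "(('w \<Rightarrow> real) \<Rightarrow> ereal) \<Rightarrow> (real \<Rightarrow> 'a \<Rightarrow> 'z \<Rightarrow> real) \<Rightarrow> ('w \<Rightarrow> 'z) \<Rightarrow>
     (real \<Rightarrow> 'a \<Rightarrow> real \<Rightarrow> real) \<Rightarrow> real \<Rightarrow> (real \<times> 'a) set \<Rightarrow> (real \<Rightarrow> ereal) \<Rightarrow> real \<Rightarrow> ereal" where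
  "bellman_op \<rho> T Z c \<beta> D v x = (INF a \<in> D `` {x}. stage_risk \<rho> T Z c \<beta> v x a)"

definition policy_value ::
    "(('w \<Rightarrow> real) \<Rightarrow> ereal) \<Rightarrow> (real \<Rightarrow> 'a \<Rightarrow> 'z \<Rightarrow> real) \<Rightarrow> ('w \<Rightarrow> 'z) \<Rightarrow>
     (real \<Rightarrow> 'a \<Rightarrow> real \<Rightarrow> real) \<Rightarrow> real \<Rightarrow> nat \<Rightarrow> (nat \<Rightarrow> real \<Rightarrow> 'a) \<Rightarrow> real \<Rightarrow> ereal" where
  "policy_value \<rho> T Z c \<beta> N \<pi> = foldr (\<lambda>n. policy_op \<rho> T Z c \<beta> (\<pi> n)) [0..<N] (\<lambda>_. 0)"

definition value_classI :: "real \<Rightarrow> (real \<Rightarrow> real) \<Rightarrow> (real \<Rightarrow> ereal) set" where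
  "value_classI lo hi =
     {\<lambda>x. ereal (v x) | v. lsc_on UNIV v \<and> mono v \<and> (\<forall>x. lo \<le> v x \<and> v x \<le> hi x)}"

definition weighted_norm :: "(real \<Rightarrow> real) \<Rightarrow> (real \<Rightarrow> ereal) \<Rightarrow> ereal" where
  "weighted_norm b v = (SUP x. \<bar>v x\<bar> / ereal (b x))"

end

theory Submission
  imports Defs
begin

text \<open>Functions that increase in the next state are comonotonic, so on increasing value functions
  the risk measure is additive and the Bellman operator inherits the modulus \<open>\<alpha> * \<beta>\<close> from the growth
  of \<open>b_hi\<close>. Lower semicontinuity of the risk in state and action follows from the Fatou property;
  together with the compact upper semicontinuous action sets it makes the Bellman operator map \<open>I\<close>
  into itself and yields measurable minimisers, hence \<open>JN N\<close> is the \<open>N\<close>-th Bellman iterate of \<open>0\<close>.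
  A general policy value is not monotone in the state; its convergence uses instead that the costs are
  bounded below, so that by translation invariance it increases in \<open>N\<close> up to a vanishing
  correction.\<close>

section \<open>Lower semicontinuity\<close>

text \<open>\<open>\<rho>\<close> need not be subadditive, so differences of risks are estimated in
  two separate ways. Splitting off a multiple of \<open>b\<close> needs an increasing reference
  function, because additivity is tied to comonotonicity; this drives the fixed point argument.
  Splitting off a constant works for every measurable value function and gives the factor
  \<open>\<beta>\<close>, which is less than 1 because \<alpha> is at least 1. Value functions are
  bounded by constants only from below, so for policies this second way yields one-sided estimates.
  They suffice: a greedy stationary policy has to be bounded from above only, since the Bellman
  iterates lie below the values of every policy.\<close>

lemma lsc_on_eventually:
  fixes s :: "nat \<Rightarrow> 'x::topological_space"
  assumes "lsc_on S f" "x \<in> S" "\<And>n. s n \<in> S" "s \<longlonglongrightarrow> x" "y < f x"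
  shows "eventually (\<lambda>n. y < f (s n)) sequentially"
proof -
  have "eventually (\<lambda>x'. y < f x') (at x within S)"
    using assms unfolding lsc_on_def by blast
  then obtain U where "open U" "x \<in> U" "\<And>u. u \<in> U \<Longrightarrow> u \<noteq> x \<Longrightarrow> u \<in> S \<Longrightarrow> y < f u"
    unfolding eventually_at_topological by blast
  moreover from this have "eventually (\<lambda>n. s n \<in> U) sequentially"
    using assms(4) by (simp add: topological_tendstoD)
  ultimately show ?thesis
    using assms(3,5) by (auto elim!: eventually_mono)
qed

lemma lsc_on_UNIV_I:
  assumes "\<And>r. closed {x. f x \<le> r}"
  shows "lsc_on UNIV f"
  unfolding lsc_on_def
proof (intro ballI allI impI)
  fix x y assume "y < f x"
  moreover have "open {x. y < f x}"
    using assms[of y] by (simp add: closed_def Compl_eq not_le)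
  ultimately show "eventually (\<lambda>x'. y < f x') (at x within UNIV)"
    unfolding eventually_at_topological by blast
qed

text \<open>Capping at \<open>l\<close> turns a one-sided bound into convergence. In this form lower
  semicontinuity can be fed into the Fatou property and into the joint semicontinuity of
  \<open>c\<close>.\<close>

lemma min_tendstoI:
  fixes f :: "nat \<Rightarrow> real"
  assumes "\<And>y. y < l \<Longrightarrow> eventually (\<lambda>n. y < f n) sequentially"
  shows "(\<lambda>n. min (f n) l) \<longlonglongrightarrow> l"
proof (rule order_tendstoI)
  fix y assume "y < l"
  with assms show "eventually (\<lambda>n. y < min (f n) l) sequentially" by simp
next
  fix y assume "l < y"
  then show "eventually (\<lambda>n. min (f n) l < y) sequentially" by (simp add: min_less_iff_disj)
qed

section \<open>Measurable selection of minimisers\<close>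

lemma compact_nested_Inter:
  fixes K :: "nat \<Rightarrow> 'a::t2_space set"
  assumes "\<And>n. compact (K n)" "\<And>n. K n \<noteq> {}" "decseq K"
  shows "(\<Inter>n. K n) \<noteq> {}"
proof -
  have "K 0 \<inter> (\<Inter>n\<in>UNIV. K n) \<noteq> {}"
  proof (rule compact_imp_fip_image)
    fix I' :: "nat set" assume I': "finite I'"
    have "K (Max (insert 0 I')) \<subseteq> K i" if "i \<in> insert 0 I'" for i
      using I' that by (intro decseqD[OF assms(3)] Max_ge) auto
    then have "K (Max (insert 0 I')) \<subseteq> K 0 \<inter> (\<Inter>i\<in>I'. K i)" by blast
    with assms(2) show "K 0 \<inter> (\<Inter>i\<in>I'. K i) \<noteq> {}" by (metis subset_empty)
  qed (use assms in \<open>auto intro: compact_imp_closed\<close>)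
  then show ?thesis by blast
qed

definition argmin_set :: "('a \<Rightarrow> real) \<Rightarrow> 'a set \<Rightarrow> 'a set" where
  "argmin_set L F = {a \<in> F. \<forall>b\<in>F. L a \<le> L b}"

text \<open>Compact sublevel sets stand in for lower semicontinuity. Among finitely many competitors
  the one of least value lies in all their sublevel sets, so by compactness some point lies in the
  sublevel sets of all competitors.\<close>

lemma minimum_attained:
  fixes F C :: "'a::t2_space set" and L :: "'a \<Rightarrow> real"
  assumes "\<And>r. compact {a\<in>F. L a \<le> r}" "closed C" "F \<inter> C \<noteq> {}"
  shows "\<exists>a\<in>F \<inter> C. \<forall>b\<in>F \<inter> C. L a \<le> L b"
proof -
  obtain a0 where a0: "a0 \<in> F \<inter> C" using assms(3) by blast
  let ?K = "\<lambda>b. {a\<in>F. L a \<le> L b} \<inter> C"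
  have K: "compact (?K b)" for b
    using assms(1,2) by (rule compact_Int_closed)
  have "?K a0 \<inter> (\<Inter>b\<in>F \<inter> C. ?K b) \<noteq> {}"
  proof (rule compact_imp_fip_image)
    fix I' assume I': "finite I'" "I' \<subseteq> F \<inter> C"
    obtain m where m: "m \<in> insert a0 I'" "\<And>b. b \<in> insert a0 I' \<Longrightarrow> L m \<le> L b"
      using arg_min_if_finite[of "insert a0 I'" L] I'
      by (metis finite_insert insert_not_empty not_le)
    then have "m \<in> ?K a0 \<inter> (\<Inter>b\<in>I'. ?K b)" using a0 I'(2) by auto
    then show "?K a0 \<inter> (\<Inter>b\<in>I'. ?K b) \<noteq> {}" by blast
  qed (use K in \<open>auto intro: compact_imp_closed\<close>)
  then show ?thesis by blast
qed

lemma argmin_set_compact: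
  fixes F :: "'a::t2_space set"
  assumes "\<And>r. compact {a\<in>F. L a \<le> r}" "F \<noteq> {}"
  shows "compact (argmin_set L F)" "argmin_set L F \<noteq> {}"
proof -
  obtain a where a: "a \<in> F" "\<And>b. b \<in> F \<Longrightarrow> L a \<le> L b"
    using minimum_attained[of F L UNIV] assms by auto
  then have "argmin_set L F = {b\<in>F. L b \<le> L a}"
    by (auto simp: argmin_set_def intro: order_trans)
  with assms(1) show "compact (argmin_set L F)" by simp
  show "argmin_set L F \<noteq> {}" using a by (auto simp: argmin_set_def)
qed

text \<open>Since the minima are attained, comparing the minimum over \<open>F x \<inter> C\<close> with the one over \<open>F x\<close>
  only takes countably many rational levels.\<close>

lemma argmin_set_hit_measurable:
  fixes F :: "'x \<Rightarrow> 'a::t2_space set" and L :: "'x \<Rightarrow> 'a \<Rightarrow> real"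
  assumes compact: "\<And>x r. x \<in> space N \<Longrightarrow> compact {a\<in>F x. L x a \<le> r}"
    and nonempty: "\<And>x. x \<in> space N \<Longrightarrow> F x \<noteq> {}"
    and meas: "\<And>C r. closed C \<Longrightarrow> {x\<in>space N. \<exists>a\<in>F x \<inter> C. L x a \<le> r} \<in> sets N"
    and C: "closed C"
  shows "{x\<in>space N. argmin_set (L x) (F x) \<inter> C \<noteq> {}} \<in> sets N"
proof -
  have "argmin_set (L x) (F x) \<inter> C \<noteq> {} \<longleftrightarrow>
      (\<forall>q::rat. (\<exists>a\<in>F x \<inter> UNIV. L x a \<le> of_rat q) \<longrightarrow> (\<exists>a\<in>F x \<inter> C. L x a \<le> of_rat q))"
    (is "?l \<longleftrightarrow> ?r") if x: "x \<in> space N" for x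
  proof
    assume ?l
    then obtain a where "a \<in> F x \<inter> C" "\<And>b. b \<in> F x \<Longrightarrow> L x a \<le> L x b"
      by (auto simp: argmin_set_def)
    then show ?r by (metis IntD1 order_trans)
  next
    assume r: ?r
    obtain m where m: "m \<in> F x" "\<And>b. b \<in> F x \<Longrightarrow> L x m \<le> L x b"
      using minimum_attained[of "F x" "L x" UNIV] compact nonempty x by auto
    obtain q where "L x m < of_rat q" using of_rat_dense[of "L x m" "L x m + 1"] by auto
    with r m(1) have "F x \<inter> C \<noteq> {}" by (metis IntI UNIV_I empty_iff less_imp_le)
    then obtain a where a: "a \<in> F x \<inter> C" "\<And>b. b \<in> F x \<inter> C \<Longrightarrow> L x a \<le> L x b"
      using minimum_attained[of "F x" "L x" C] compact x C by blast
    have "L x a \<le> L x m"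
    proof (rule ccontr)
      assume "\<not> L x a \<le> L x m"
      then obtain q where q: "L x m < of_rat q" "of_rat q < L x a"
        using of_rat_dense[of "L x m" "L x a"] by auto
      then obtain a' where "a' \<in> F x \<inter> C" "L x a' \<le> of_rat q"
        using r m(1) by (metis IntI UNIV_I less_imp_le)
      with a(2)[of a'] q(2) show False by simp
    qed
    with m have "\<And>b. b \<in> F x \<Longrightarrow> L x a \<le> L x b" by (meson order_trans)
    with a(1) show ?l by (auto simp: argmin_set_def)
  qed
  then have "{x\<in>space N. argmin_set (L x) (F x) \<inter> C \<noteq> {}} =
      {x\<in>space N. \<forall>q::rat. (\<exists>a\<in>F x \<inter> UNIV. L x a \<le> of_rat q) \<longrightarrow> (\<exists>a\<in>F x \<inter> C. L x a \<le> of_rat q)}"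
    by blast
  also have "\<dots> \<in> sets N"
    by (intro sets.sets_Collect_countable_All sets.sets_Collect_imp meas C closed_UNIV)
  finally show ?thesis .
qed

text \<open>Minimising successively the distances to the points of a dense sequence shrinks each \<open>F x\<close> to
  a single point, while every step preserves compactness and measurability.\<close>

lemma compact_measurable_selection:
  fixes F :: "'x \<Rightarrow> 'a::{metric_space, second_countable_topology} set"
  assumes compact: "\<And>x. x \<in> space N \<Longrightarrow> compact (F x)"
    and nonempty: "\<And>x. x \<in> space N \<Longrightarrow> F x \<noteq> {}"
    and meas: "\<And>C. closed C \<Longrightarrow> {x\<in>space N. F x \<inter> C \<noteq> {}} \<in> sets N"
  shows "\<exists>d \<in> borel_measurable N. \<forall>x\<in>space N. d x \<in> F x"
proof -
  obtain Q :: "'a set" where Q: "countable Q" "\<And>X. open X \<Longrightarrow> X \<noteq> {} \<Longrightarrow> \<exists>q\<in>Q. q \<in> X"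
    using countable_dense_setE by blast
  define q where "q = from_nat_into Q"
  define K where "K n x = rec_nat (F x) (\<lambda>k. argmin_set (\<lambda>a. dist a (q k))) n" for n x
  have K0: "K 0 x = F x" and KSuc: "K (Suc n) x = argmin_set (\<lambda>a. dist a (q n)) (K n x)" for n x
    by (simp_all add: K_def)
  have closed_dist: "closed {a. dist a (q n) \<le> r}" for n r
    by (intro closed_Collect_le continuous_intros)
  have sub: "compact {a\<in>K n x. dist a (q n) \<le> r}" if "compact (K n x)" for n x r
  proof -
    have "{a\<in>K n x. dist a (q n) \<le> r} = K n x \<inter> {a. dist a (q n) \<le> r}" by auto
    then show ?thesis using compact_Int_closed[OF that closed_dist] by simp
  qed
  have K_compact: "compact (K n x) \<and> K n x \<noteq> {}" if "x \<in> space N" for n x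
  proof (induction n)
    case 0
    then show ?case using compact nonempty that by (simp add: K0)
  next
    case (Suc n)
    then show ?case unfolding KSuc using sub by (intro conjI argmin_set_compact) auto
  qed
  have K_meas: "{x\<in>space N. K n x \<inter> C \<noteq> {}} \<in> sets N" if "closed C" for n C
    using that
  proof (induction n arbitrary: C)
    case 0
    then show ?case using meas by (simp add: K0)
  next
    case (Suc n)
    show ?case unfolding KSuc
    proof (rule argmin_set_hit_measurable[OF _ _ _ Suc.prems])
      fix C' :: "'a set" and r assume "closed C'"
      then have "{x\<in>space N. K n x \<inter> (C' \<inter> {a. dist a (q n) \<le> r}) \<noteq> {}} \<in> sets N"
        using closed_dist by (intro Suc.IH closed_Int)
      also have "{x\<in>space N. K n x \<inter> (C' \<inter> {a. dist a (q n) \<le> r}) \<noteq> {}} =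
          {x\<in>space N. \<exists>a\<in>K n x \<inter> C'. dist a (q n) \<le> r}" by auto
      finally show "{x\<in>space N. \<exists>a\<in>K n x \<inter> C'. dist a (q n) \<le> r} \<in> sets N" .
    qed (use K_compact sub in auto)
  qed
  have decr: "decseq (\<lambda>n. K n x)" for x
    by (rule decseq_SucI) (auto simp: KSuc argmin_set_def)
  define d where "d x = (SOME a. a \<in> (\<Inter>n. K n x))" for x
  have d: "d x \<in> (\<Inter>n. K n x)" if "x \<in> space N" for x
    using compact_nested_Inter[of "\<lambda>n. K n x"] K_compact[OF that] decr
    unfolding d_def by (intro someI_ex[of "\<lambda>a. a \<in> _"]) blast
  \<comment> \<open>Two points of the intersection minimise each distance over the same set and are
    thus equally far from every \<open>q n\<close>; a \<open>q n\<close> close to one of them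
    excludes the other.\<close>
  have unique: "a = d x" if x: "x \<in> space N" and a: "a \<in> (\<Inter>n. K n x)" for a x
  proof (rule ccontr)
    assume "a \<noteq> d x"
    then have "0 < dist a (d x)" by simp
    then obtain p where "p \<in> Q" "dist p a < dist a (d x) / 2"
      using Q(2)[of "ball a (dist a (d x) / 2)"] by (auto simp: dist_commute)
    then obtain n where n: "dist (q n) a < dist a (d x) / 2"
      unfolding q_def using from_nat_into_surj[OF Q(1)] by metis
    have "a \<in> K (Suc n) x" "d x \<in> K (Suc n) x" using a d[OF x] by blast+
    then have "dist a (q n) = dist (d x) (q n)"
      unfolding KSuc argmin_set_def by (auto intro: antisym)
    with n have "dist a (d x) < dist a (d x)"
      using dist_triangle_half_l[of a "q n" "dist a (d x)" "d x"] by (simp add: dist_commute)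
    then show False by simp
  qed
  \<comment> \<open>This writes the preimage of a closed set as a countable intersection of
    measurable sets: nested compact sets that all meet \<open>C\<close> have a common point in
    \<open>C\<close>, and it must be \<open>d x\<close>.\<close>
  have hit: "d x \<in> C \<longleftrightarrow> (\<forall>n. K n x \<inter> C \<noteq> {})" if x: "x \<in> space N" and C: "closed C" for x C
  proof
    assume "\<forall>n. K n x \<inter> C \<noteq> {}"
    moreover have "decseq (\<lambda>n. K n x \<inter> C)"
      using decr[of x] unfolding decseq_def by blast
    ultimately have "(\<Inter>n. K n x \<inter> C) \<noteq> {}"
      using K_compact[OF x] C by (intro compact_nested_Inter compact_Int_closed) auto
    then show "d x \<in> C" using unique[OF x] by auto
  qed (use d[OF x] in blast)
  have "d \<in> borel_measurable N"
  proof (rule borel_measurableI)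
    fix U :: "'a set" assume "open U"
    then have C: "closed (- U)" by (simp add: closed_def)
    have "{x\<in>space N. \<forall>n. K n x \<inter> - U \<noteq> {}} \<in> sets N"
      using C by (intro sets.sets_Collect_countable_All K_meas)
    then have "space N - {x\<in>space N. \<forall>n. K n x \<inter> - U \<noteq> {}} \<in> sets N" by blast
    also have "space N - {x\<in>space N. \<forall>n. K n x \<inter> - U \<noteq> {}} = d -` U \<inter> space N"
      using hit[OF _ C] by blast
    finally show "d -` U \<inter> space N \<in> sets N" .
  qed
  moreover have "\<forall>x\<in>space N. d x \<in> F x" using d K0 by blast
  ultimately show ?thesis by blast
qed

section \<open>The space of p-integrable functions\<close>

lemma Lp_space_dominated:
  assumes "0 \<le> p" "X \<in> borel_measurable M" "Y \<in> Lp_space M p"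
    and "\<And>w. w \<in> space M \<Longrightarrow> \<bar>X w\<bar> \<le> \<bar>Y w\<bar>"
  shows "X \<in> Lp_space M p"
proof -
  have "integrable M (\<lambda>w. \<bar>X w\<bar> powr p)"
  proof (rule Bochner_Integration.integrable_bound)
    show "integrable M (\<lambda>w. \<bar>Y w\<bar> powr p)"
      using assms(3) by (simp add: Lp_space_def)
    show "AE w in M. norm (\<bar>X w\<bar> powr p) \<le> norm (\<bar>Y w\<bar> powr p)"
      using assms(1,4) by (auto intro!: AE_I2 powr_mono2)
  qed (use assms(2) in measurable)
  with assms show ?thesis by (simp add: Lp_space_def)
qed

lemma Lp_space_const: "finite_measure M \<Longrightarrow> (\<lambda>_. r) \<in> Lp_space M p"
  by (simp add: Lp_space_def finite_measure.integrable_const)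

lemma Lp_space_cmult:
  assumes "X \<in> Lp_space M p"
  shows "(\<lambda>w. r * X w) \<in> Lp_space M p"
  using assms by (auto simp: Lp_space_def abs_mult powr_mult)

lemma Lp_space_add:
  assumes "0 \<le> p" "X \<in> Lp_space M p" "Y \<in> Lp_space M p"
  shows "(\<lambda>w. X w + Y w) \<in> Lp_space M p"
proof -
  have [measurable]: "X \<in> borel_measurable M" "Y \<in> borel_measurable M"
    using assms by (auto simp: Lp_space_def)
  \<comment> \<open>Bounding the sum by twice the larger summand reduces this to monotonicity of the
    power.\<close>
  have le: "\<bar>x + y\<bar> powr p \<le> 2 powr p * (\<bar>x\<bar> powr p + \<bar>y\<bar> powr p)" for x y :: real
  proof -
    have "\<bar>x + y\<bar> powr p \<le> (2 * max \<bar>x\<bar> \<bar>y\<bar>) powr p"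
      using assms(1) by (intro powr_mono2) auto
    also have "\<dots> = 2 powr p * max \<bar>x\<bar> \<bar>y\<bar> powr p"
      by (rule powr_mult)
    also have "max \<bar>x\<bar> \<bar>y\<bar> powr p \<le> \<bar>x\<bar> powr p + \<bar>y\<bar> powr p"
      by (cases "\<bar>x\<bar> \<le> \<bar>y\<bar>") (simp_all add: max_def)
    finally show ?thesis by simp
  qed
  have "integrable M (\<lambda>w. \<bar>X w + Y w\<bar> powr p)"
  proof (rule Bochner_Integration.integrable_bound)
    show "integrable M (\<lambda>w. 2 powr p * (\<bar>X w\<bar> powr p + \<bar>Y w\<bar> powr p))"
      using assms by (auto simp: Lp_space_def)
    show "AE w in M. norm (\<bar>X w + Y w\<bar> powr p) \<le> norm (2 powr p * (\<bar>X w\<bar> powr p + \<bar>Y w\<bar> powr p))"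
      using le by (intro AE_I2) auto
  qed measurable
  then show ?thesis by (simp add: Lp_space_def)
qed

section \<open>The decision model\<close>

locale risk_mdp = prob_space M
  for M :: "'w measure" +
  fixes p :: real and \<rho> :: "('w \<Rightarrow> real) \<Rightarrow> ereal"
    and MZ :: "'z measure" and Z :: "'w \<Rightarrow> 'z"
    and A :: "'a::polish_space set" and D :: "(real \<times> 'a) set"
    and T :: "real \<Rightarrow> 'a \<Rightarrow> 'z \<Rightarrow> real" and c :: "real \<Rightarrow> 'a \<Rightarrow> real \<Rightarrow> real"
    and \<alpha> \<beta> b_lo :: real and b_hi :: "real \<Rightarrow> real"
  assumes p: "1 \<le> p"
    and Z: "Z \<in> M \<rightarrow>\<^sub>M MZ"
    and D: "D \<in> sets (borel \<Otimes>\<^sub>M restrict_space borel A)"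
    and D_nonempty: "\<And>x. D `` {x} \<noteq> {}"
    and T: "(\<lambda>((x, a), z). T x a z)
              \<in> restrict_space (borel \<Otimes>\<^sub>M restrict_space borel A) D \<Otimes>\<^sub>M MZ \<rightarrow>\<^sub>M borel"
    and \<beta>: "0 < \<beta>"
    and D_usc: "\<And>xs x as. xs \<longlonglongrightarrow> x \<Longrightarrow> (\<And>k. as k \<in> D `` {xs k}) \<Longrightarrow>
                  \<exists>a \<in> D `` {x}. \<exists>r. strict_mono (r :: nat \<Rightarrow> nat) \<and> (as \<circ> r) \<longlonglongrightarrow> a"
    and D_decr: "\<And>x y. x \<le> y \<Longrightarrow> D `` {y} \<subseteq> D `` {x}"
    and T_lsc: "\<And>z. z \<in> space MZ \<Longrightarrow> lsc_on D (\<lambda>(x, a). T x a z)"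
    and T_incr: "\<And>z x y a. z \<in> space MZ \<Longrightarrow> (x, a) \<in> D \<Longrightarrow> (y, a) \<in> D \<Longrightarrow> x \<le> y \<Longrightarrow>
                   T x a z \<le> T y a z"
    and c_lsc: "lsc_on (D \<times> UNIV) (\<lambda>((x, a), x'). c x a x')"
    and c_incr: "\<And>x y a x' y'. (x, a) \<in> D \<Longrightarrow> (y, a) \<in> D \<Longrightarrow> x \<le> y \<Longrightarrow> x' \<le> y' \<Longrightarrow>
                   c x a x' \<le> c y a y'"
    and b_lo: "b_lo \<le> 0" and \<alpha>: "1 \<le> \<alpha>"
    and b_hi_mono: "mono b_hi" and b_hi_nonneg: "\<And>x. 0 \<le> b_hi x"
    and b_ge_1: "\<And>x. 1 \<le> b_hi x - b_lo"
    and c_lower: "\<And>x a. (x, a) \<in> D \<Longrightarrow> AE w in M. b_lo \<le> c x a (T x a (Z w))"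
    and c_upper: "\<And>x a. (x, a) \<in> D \<Longrightarrow> \<rho> (\<lambda>w. c x a (T x a (Z w))) \<le> ereal (b_hi x)"
    and b_hi_growth: "\<And>x a. (x, a) \<in> D \<Longrightarrow> \<rho> (\<lambda>w. b_hi (T x a (Z w))) \<le> ereal (\<alpha> * b_hi x)"
    and integrability: "\<And>x0 a0. (x0, a0) \<in> D \<Longrightarrow>
          \<exists>\<epsilon>>0. \<exists>\<Theta>1 \<in> borel_measurable MZ. \<exists>\<Theta>2 \<in> borel_measurable MZ.
            (\<forall>z\<in>space MZ. 0 \<le> \<Theta>1 z \<and> 0 \<le> \<Theta>2 z) \<and>
            (\<lambda>w. \<Theta>1 (Z w)) \<in> Lp_space M p \<and> (\<lambda>w. \<Theta>2 (Z w)) \<in> Lp_space M p \<and>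
            (\<forall>z\<in>space MZ. \<forall>(x, a) \<in> D \<inter> cball (x0, a0) \<epsilon>.
               \<bar>c x a (T x a z)\<bar> \<le> \<Theta>1 z \<and> b_hi (T x a z) - b_lo \<le> \<Theta>2 z)"
    and monetary: "monetary M p \<rho>" and comonotonic_additive: "comonotonic_additive M p \<rho>"
    and pos_homogeneous: "pos_homogeneous M p \<rho>" and fatou: "fatou_property M p \<rho>"
    and discounting: "\<alpha> * \<beta> < 1"
    and policy_value_measurable: "\<And>\<pi> N. \<pi> \<in> markov_policies A D \<Longrightarrow>
          policy_value \<rho> T Z c \<beta> N \<pi> \<in> borel_measurable borel"
begin

abbreviation b :: "real \<Rightarrow> real" where "b x \<equiv> b_hi x - b_lo"

text \<open>The sum of the geometric series with ratio \<open>\<alpha> * \<beta>\<close>, that is,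
  the solution of \<open>t = 1 + \<alpha> * \<beta> * t\<close>. Hence a stage of cost
  \<open>b_hi\<close>, followed by a continuation \<open>hi\<close> whose risk grows by \<alpha> and
  is discounted by \<beta>, reproduces \<open>hi\<close>.\<close>

definition \<kappa> :: real where "\<kappa> = 1 / (1 - \<alpha> * \<beta>)"

abbreviation lo :: real where "lo \<equiv> \<kappa> * b_lo"
abbreviation hi :: "real \<Rightarrow> real" where "hi x \<equiv> \<kappa> * b_hi x"

lemma \<kappa>_pos: "0 < \<kappa>" and \<kappa>_eq: "1 + \<alpha> * \<beta> * \<kappa> = \<kappa>"
  using discounting by (simp_all add: \<kappa>_def field_simps)

lemma lo_nonpos: "lo \<le> 0"
  using \<kappa>_pos b_lo by (simp add: mult_nonneg_nonpos)

lemma \<beta>_less_1: "\<beta> < 1"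
  using \<beta> discounting mult_right_mono[OF \<alpha>, of \<beta>] by linarith

text \<open>Constants pass through \<rho> unchanged, so a constant lower bound is transported with
  factor \<open>\<beta>\<close> alone. The larger factor \<open>\<alpha> * \<beta>\<close> built
  into \<open>\<kappa>\<close> only lowers the bound, because \<open>lo\<close> is
  nonpositive.\<close>

lemma lo_le: "lo \<le> b_lo + \<beta> * lo"
proof -
  have "\<alpha> * \<beta> * lo \<le> \<beta> * lo"
    using \<alpha> \<beta> lo_nonpos by (intro mult_right_mono_neg) auto
  moreover have "lo = b_lo + \<alpha> * \<beta> * lo"
    using arg_cong[OF \<kappa>_eq, of "\<lambda>t. t * b_lo"] by (simp add: algebra_simps)
  ultimately show ?thesis by simp
qed

lemma hi_eq: "hi x = b_hi x + \<beta> * \<kappa> * (\<alpha> * b_hi x)"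
  using arg_cong[OF \<kappa>_eq, of "\<lambda>t. t * b_hi x"] by (simp add: algebra_simps)

section \<open>Risk of the next state\<close>

lemma Z_space: "w \<in> space M \<Longrightarrow> Z w \<in> space MZ"
  using Z by (rule measurable_space)

lemma T_measurable:
  assumes "(x, a) \<in> D"
  shows "(\<lambda>w. T x a (Z w)) \<in> borel_measurable M"
proof -
  have "(x, a) \<in> space (restrict_space (borel \<Otimes>\<^sub>M restrict_space borel A) D)"
    using assms sets.sets_into_space[OF D] by (auto simp: space_restrict_space)
  then have "(\<lambda>w. ((x, a), Z w)) \<in>
      M \<rightarrow>\<^sub>M restrict_space (borel \<Otimes>\<^sub>M restrict_space borel A) D \<Otimes>\<^sub>M MZ"
    using Z by (intro measurable_Pair measurable_const) auto
  from measurable_compose[OF this T] show ?thesis by simp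
qed

lemma c_mono: "(x, a) \<in> D \<Longrightarrow> mono (c x a)"
  by (rule monoI) (simp add: c_incr)

lemma c_Lp: "(\<lambda>w. c x a (T x a (Z w))) \<in> Lp_space M p"
  and b_Lp: "(\<lambda>w. b (T x a (Z w))) \<in> Lp_space M p"
  if xa: "(x, a) \<in> D"
proof -
  obtain \<epsilon> \<Theta>1 \<Theta>2 where \<Theta>: "0 < \<epsilon>" "(\<lambda>w. \<Theta>1 (Z w)) \<in> Lp_space M p" "(\<lambda>w. \<Theta>2 (Z w)) \<in> Lp_space M p"
    "\<forall>z\<in>space MZ. \<forall>(x', a') \<in> D \<inter> cball (x, a) \<epsilon>.
       \<bar>c x' a' (T x' a' z)\<bar> \<le> \<Theta>1 z \<and> b (T x' a' z) \<le> \<Theta>2 z"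
    using integrability[OF xa] by blast
  then have le: "\<bar>c x a (T x a z)\<bar> \<le> \<Theta>1 z" "b (T x a z) \<le> \<Theta>2 z" if "z \<in> space MZ" for z
    using that xa by fastforce+
  \<comment> \<open>Measurability of the cost in the next state is a consequence of its
    monotonicity.\<close>
  have "(\<lambda>w. c x a (T x a (Z w))) \<in> borel_measurable M"
    using borel_measurable_mono[OF c_mono[OF xa]] T_measurable[OF xa] by (rule measurable_compose[rotated])
  then show "(\<lambda>w. c x a (T x a (Z w))) \<in> Lp_space M p"
    using p le(1) Z_space by (intro Lp_space_dominated[OF _ _ \<Theta>(2)])
      (auto intro: order_trans[OF _ abs_ge_self])
  have "(\<lambda>w. b_hi (T x a (Z w))) \<in> borel_measurable M"
    using borel_measurable_mono[OF b_hi_mono] T_measurable[OF xa] by (rule measurable_compose[rotated])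
  then show "(\<lambda>w. b (T x a (Z w))) \<in> Lp_space M p"
    using p le(2) Z_space b_ge_1[THEN order_trans[OF zero_le_one]]
    by (intro Lp_space_dominated[OF _ _ \<Theta>(3)]) (auto intro: order_trans[OF _ abs_ge_self])
qed

text \<open>The measurable functions of finite \<open>b\<close>-weighted norm. Their total costs lie
  in the domain of \<rho>, and unlike the value classes below this space is closed under adding
  multiples of \<open>b\<close>.\<close>

definition weight_bounded :: "(real \<Rightarrow> real) \<Rightarrow> bool" where
  "weight_bounded v \<longleftrightarrow> v \<in> borel_measurable borel \<and> (\<exists>k. \<forall>x. \<bar>v x\<bar> \<le> k * b x)"

lemma weight_boundedI:
  "v \<in> borel_measurable borel \<Longrightarrow> (\<And>x. \<bar>v x\<bar> \<le> k * b x) \<Longrightarrow> weight_bounded v"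
  by (auto simp: weight_bounded_def)

lemma weight_bounded_lin:
  assumes "weight_bounded v" "weight_bounded h"
  shows "weight_bounded (\<lambda>x. v x + k * h x)"
proof -
  obtain k1 k2 where k: "\<And>x. \<bar>v x\<bar> \<le> k1 * b x" "\<And>x. \<bar>h x\<bar> \<le> k2 * b x"
    using assms by (auto simp: weight_bounded_def)
  have "\<bar>v x + k * h x\<bar> \<le> (k1 + \<bar>k\<bar> * k2) * b x" for x
  proof -
    have "\<bar>v x + k * h x\<bar> \<le> \<bar>v x\<bar> + \<bar>k\<bar> * \<bar>h x\<bar>"
      by (metis abs_mult abs_triangle_ineq)
    also have "\<dots> \<le> k1 * b x + \<bar>k\<bar> * (k2 * b x)"
      using k by (intro add_mono mult_left_mono) auto
    finally show ?thesis by (simp add: algebra_simps)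
  qed
  then show ?thesis
    using assms by (intro weight_boundedI) (auto simp: weight_bounded_def)
qed

lemma weight_bounded_b: "weight_bounded b"
  using borel_measurable_mono[OF b_hi_mono] b_ge_1[THEN order_trans[OF zero_le_one]]
  by (intro weight_boundedI[where k = 1]) auto

lemma weight_bounded_b_hi: "weight_bounded b_hi"
  using borel_measurable_mono[OF b_hi_mono] b_hi_nonneg b_lo
  by (intro weight_boundedI[where k = 1]) auto

lemma weight_bounded_0: "weight_bounded (\<lambda>_. 0)"
  by (intro weight_boundedI[where k = 0]) auto

lemma weight_bounded_Lp:
  assumes "weight_bounded v" "(x, a) \<in> D"
  shows "(\<lambda>w. v (T x a (Z w))) \<in> Lp_space M p"
proof -
  obtain k where k: "\<And>x. \<bar>v x\<bar> \<le> k * b x" and v: "v \<in> borel_measurable borel"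
    using assms(1) by (auto simp: weight_bounded_def)
  have "(\<lambda>w. v (T x a (Z w))) \<in> borel_measurable M"
    using v T_measurable[OF assms(2)] by (rule measurable_compose[rotated])
  then show ?thesis
    using p k by (intro Lp_space_dominated[OF _ _ Lp_space_cmult[OF b_Lp[OF assms(2)], of k]])
      (auto intro: order_trans[OF _ abs_ge_self])
qed

abbreviation total_cost :: "(real \<Rightarrow> real) \<Rightarrow> real \<Rightarrow> 'a \<Rightarrow> 'w \<Rightarrow> real" where
  "total_cost v x a w \<equiv> c x a (T x a (Z w)) + \<beta> * v (T x a (Z w))"

lemma total_cost_Lp: "weight_bounded v \<Longrightarrow> (x, a) \<in> D \<Longrightarrow> total_cost v x a \<in> Lp_space M p"
  using p by (intro Lp_space_add Lp_space_cmult c_Lp weight_bounded_Lp) auto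

section \<open>Elementary properties of the risk measure\<close>

lemma \<rho>_mono:
  "X \<in> Lp_space M p \<Longrightarrow> Y \<in> Lp_space M p \<Longrightarrow> AE w in M. X w \<le> Y w \<Longrightarrow> \<rho> X \<le> \<rho> Y"
  using monetary by (simp add: monetary_def)

lemma \<rho>_shift: "X \<in> Lp_space M p \<Longrightarrow> \<rho> (\<lambda>w. X w + m) = \<rho> X + ereal m"
  using monetary by (simp add: monetary_def)

lemma \<rho>_scale: "X \<in> Lp_space M p \<Longrightarrow> 0 \<le> l \<Longrightarrow> \<rho> (\<lambda>w. l * X w) = ereal l * \<rho> X"
  using pos_homogeneous by (simp add: pos_homogeneous_def)

lemma const_Lp: "(\<lambda>_. r) \<in> Lp_space M p"
  by (rule Lp_space_const) (rule finite_measure_axioms)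

text \<open>Homogeneity with factor 0 fixes the value at 0, because \<open>0 * t = 0\<close> for
  every extended real \<open>t\<close>, infinite ones included; translation invariance gives the
  other constants.\<close>

lemma \<rho>_const: "\<rho> (\<lambda>_. m) = ereal m"
proof -
  have "\<rho> (\<lambda>_. 0) = 0"
    using \<rho>_scale[OF const_Lp[of 0], of 0] by (simp add: zero_ereal_def[symmetric])
  then show ?thesis using \<rho>_shift[OF const_Lp[of 0], of m] by simp
qed

lemma \<rho>_ge: "X \<in> Lp_space M p \<Longrightarrow> AE w in M. m \<le> X w \<Longrightarrow> ereal m \<le> \<rho> X"
  using \<rho>_mono[OF const_Lp, of X m] by (simp add: \<rho>_const)

text \<open>Increments of two increasing functions of the same variable have the same sign.
  Excluding \<open>-\<infinity>\<close> for both risks keeps their sum from being of the form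
  \<open>\<infinity> - \<infinity>\<close>.\<close>

lemma \<rho>_add_mono:
  fixes f g :: "real \<Rightarrow> real"
  assumes "mono f" "mono g"
    and "(\<lambda>w. f (X w)) \<in> Lp_space M p" "(\<lambda>w. g (X w)) \<in> Lp_space M p"
    and "\<rho> (\<lambda>w. f (X w)) \<noteq> -\<infinity>" "\<rho> (\<lambda>w. g (X w)) \<noteq> -\<infinity>"
  shows "\<rho> (\<lambda>w. f (X w) + g (X w)) = \<rho> (\<lambda>w. f (X w)) + \<rho> (\<lambda>w. g (X w))"
proof -
  have "0 \<le> (f s - f t) * (g s - g t)" for s t
    using assms(1,2)[THEN monoD, of s t] assms(1,2)[THEN monoD, of t s]
    by (cases rule: linorder_le_cases[of s t]) (auto simp: zero_le_mult_iff)
  then have "comonotonic M (\<lambda>w. f (X w)) (\<lambda>w. g (X w))"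
    unfolding comonotonic_def by (intro AE_I2) auto
  moreover have "{\<rho> (\<lambda>w. f (X w)), \<rho> (\<lambda>w. g (X w))} \<noteq> {-\<infinity>, \<infinity>}"
    using assms(5,6) by (auto simp: doubleton_eq_iff)
  ultimately show ?thesis
    using assms(3,4) comonotonic_additive unfolding comonotonic_additive_def by simp
qed

lemma \<rho>_total_cost_ge:
  assumes v: "weight_bounded v" "\<And>y. m \<le> v y" and xa: "(x, a) \<in> D"
  shows "ereal (b_lo + \<beta> * m) \<le> \<rho> (total_cost v x a)"
proof (rule \<rho>_ge[OF total_cost_Lp[OF v(1) xa]])
  show "AE w in M. b_lo + \<beta> * m \<le> total_cost v x a w"
    using c_lower[OF xa] \<beta> v(2) by (auto intro!: add_mono)
qed

text \<open>The total cost of an increasing \<open>v\<close> is itself increasing in the next state,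
  hence comonotonic with \<open>h\<close> there. The lower bounds on \<open>v\<close> and
  \<open>h\<close> exclude the risk \<open>-\<infinity>\<close>.\<close>

lemma \<rho>_total_cost_add:
  assumes v: "weight_bounded v" "mono v" "\<And>y. m \<le> v y"
    and h: "weight_bounded h" "mono h" "\<And>y. 0 \<le> h y"
    and k: "0 \<le> k" and xa: "(x, a) \<in> D"
  shows "\<rho> (total_cost (\<lambda>y. v y + k * h y) x a) =
    \<rho> (total_cost v x a) + ereal (\<beta> * k) * \<rho> (\<lambda>w. h (T x a (Z w)))"
proof -
  have hL: "(\<lambda>w. h (T x a (Z w))) \<in> Lp_space M p"
    by (rule weight_bounded_Lp) fact+
  have scale: "\<rho> (\<lambda>w. \<beta> * k * h (T x a (Z w))) = ereal (\<beta> * k) * \<rho> (\<lambda>w. h (T x a (Z w)))"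
    using \<beta> k by (intro \<rho>_scale hL) auto
  have mono1: "mono (\<lambda>y. c x a y + \<beta> * v y)"
    using monoD[OF c_mono[OF xa]] monoD[OF v(2)] \<beta>
    by (intro monoI add_mono mult_left_mono) auto
  have mono2: "mono (\<lambda>y. \<beta> * k * h y)"
    using monoD[OF h(2)] \<beta> k by (intro monoI mult_left_mono) auto
  have "\<rho> (total_cost v x a) \<noteq> -\<infinity>"
    using \<rho>_total_cost_ge[OF v(1,3) xa] by auto
  moreover have "ereal 0 \<le> \<rho> (\<lambda>w. \<beta> * k * h (T x a (Z w)))"
    using \<beta> k h(3) by (intro \<rho>_ge Lp_space_cmult hL AE_I2) auto
  then have "\<rho> (\<lambda>w. \<beta> * k * h (T x a (Z w))) \<noteq> -\<infinity>" by auto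
  ultimately have "\<rho> (\<lambda>w. total_cost v x a w + \<beta> * k * h (T x a (Z w))) =
      \<rho> (total_cost v x a) + \<rho> (\<lambda>w. \<beta> * k * h (T x a (Z w)))"
    by (intro \<rho>_add_mono[OF mono1 mono2] total_cost_Lp Lp_space_cmult hL v xa)
  also have "(\<lambda>w. total_cost v x a w + \<beta> * k * h (T x a (Z w))) =
      total_cost (\<lambda>y. v y + k * h y) x a"
    by (simp add: fun_eq_iff algebra_simps)
  finally show ?thesis by (simp only: scale)
qed

text \<open>Policy values are controlled only in this class, since a decision rule can destroy
  monotonicity in the state. The subclass \<open>lsc_values\<close> is \<open>I\<close> before the
  embedding into the extended reals.\<close>

definition measurable_values :: "(real \<Rightarrow> real) set" where
  "measurable_values = {v \<in> borel_measurable borel. \<forall>x. lo \<le> v x \<and> v x \<le> hi x}"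

definition lsc_values :: "(real \<Rightarrow> real) set" where
  "lsc_values = {v. lsc_on UNIV v \<and> mono v \<and> (\<forall>x. lo \<le> v x \<and> v x \<le> hi x)}"

lemma lsc_values_subset: "lsc_values \<subseteq> measurable_values"
  by (auto simp: lsc_values_def measurable_values_def intro: borel_measurable_mono)

lemma lsc_values_mono: "v \<in> lsc_values \<Longrightarrow> mono v"
  by (simp add: lsc_values_def)

lemma zero_in_lsc_values: "(\<lambda>_. 0) \<in> lsc_values"
  using lo_nonpos \<kappa>_pos b_hi_nonneg by (auto simp: lsc_values_def lsc_on_def intro: monoI)

lemma measurable_values_bounds: "v \<in> measurable_values \<Longrightarrow> lo \<le> v x" "v \<in> measurable_values \<Longrightarrow> v x \<le> hi x"
  by (auto simp: measurable_values_def)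

lemma measurable_values_abs_le:
  assumes "v \<in> measurable_values"
  shows "\<bar>v x\<bar> \<le> \<kappa> * b x"
proof -
  have "0 \<le> hi x" using \<kappa>_pos b_hi_nonneg by simp
  then show ?thesis
    using measurable_values_bounds[OF assms, of x] lo_nonpos
    unfolding right_diff_distrib abs_le_iff by linarith
qed

lemma measurable_values_weight_bounded: "v \<in> measurable_values \<Longrightarrow> weight_bounded v"
  using measurable_values_abs_le by (auto simp: weight_bounded_def measurable_values_def)

lemma measurable_values_diff:
  "v \<in> measurable_values \<Longrightarrow> w \<in> measurable_values \<Longrightarrow> v x \<le> w x + \<kappa> * b x"
  using measurable_values_bounds[of v x] measurable_values_bounds[of w x] by (simp add: algebra_simps)

definition next_risk :: "(real \<Rightarrow> real) \<Rightarrow> real \<Rightarrow> 'a \<Rightarrow> real" where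
  "next_risk v x a = real_of_ereal (\<rho> (total_cost v x a))"

lemma
  assumes v: "v \<in> measurable_values" and xa: "(x, a) \<in> D"
  shows \<rho>_total_cost: "\<rho> (total_cost v x a) = ereal (next_risk v x a)"
    and next_risk_ge_lo: "lo \<le> next_risk v x a"
    and next_risk_le_hi: "next_risk v x a \<le> hi x"
proof -
  note wb = measurable_values_weight_bounded[OF v]
  have ge: "ereal lo \<le> \<rho> (total_cost v x a)"
    using \<rho>_total_cost_ge[OF wb measurable_values_bounds(1)[OF v] xa] lo_le
    by (meson ereal_less_eq(3) order_trans)
  \<comment> \<open>The bound \<open>hi\<close> is increasing even if \<open>v\<close> is not, so
    additivity applies after this replacement; the summand 0 brings \<open>hi\<close> into the form
    needed there.\<close>
  have "\<rho> (total_cost v x a) \<le> \<rho> (total_cost (\<lambda>y. 0 + \<kappa> * b_hi y) x a)"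
    using measurable_values_bounds(2)[OF v] \<beta>
    by (intro \<rho>_mono total_cost_Lp wb weight_bounded_lin weight_bounded_0 weight_bounded_b_hi xa AE_I2)
      auto
  also have "\<dots> = \<rho> (total_cost (\<lambda>_. 0) x a) + ereal (\<beta> * \<kappa>) * \<rho> (\<lambda>w. b_hi (T x a (Z w)))"
    using \<kappa>_pos xa b_hi_nonneg
    by (intro \<rho>_total_cost_add[where m = 0] weight_bounded_0 weight_bounded_b_hi b_hi_mono)
      (auto intro: monoI)
  also have "\<dots> \<le> ereal (b_hi x) + ereal (\<beta> * \<kappa>) * ereal (\<alpha> * b_hi x)"
    using c_upper[OF xa] b_hi_growth[OF xa] \<beta> \<kappa>_pos
    by (intro add_mono ereal_mult_left_mono) auto
  also have "\<dots> = ereal (hi x)" by (simp add: hi_eq[symmetric])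
  finally have le: "\<rho> (total_cost v x a) \<le> ereal (hi x)" .
  show eq: "\<rho> (total_cost v x a) = ereal (next_risk v x a)"
    unfolding next_risk_def using ge le by (cases "\<rho> (total_cost v x a)") auto
  show "lo \<le> next_risk v x a" "next_risk v x a \<le> hi x"
    using ge le unfolding eq by auto
qed

lemma next_risk_ge:
  assumes "v \<in> measurable_values" "\<And>y. m \<le> v y" "(x, a) \<in> D"
  shows "b_lo + \<beta> * m \<le> next_risk v x a"
  using \<rho>_total_cost_ge[where v = v and m = m, OF measurable_values_weight_bounded assms(2,3)]
  by (simp add: \<rho>_total_cost assms)

text \<open>By translation invariance a constant passes through \<rho>, whatever the shape of
  \<open>u\<close>. This is the comparison available for policy values, which may fail to be
  increasing.\<close>

lemma next_risk_shift:
  assumes v: "v \<in> measurable_values" and u: "u \<in> measurable_values" and xa: "(x, a) \<in> D"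
    and le: "\<And>y. v y \<le> u y + m"
  shows "next_risk v x a \<le> next_risk u x a + \<beta> * m"
proof -
  note wb = v[THEN measurable_values_weight_bounded] u[THEN measurable_values_weight_bounded]
  have "\<beta> * v y \<le> \<beta> * u y + \<beta> * m" for y
    using mult_left_mono[OF le, of \<beta> y] \<beta> by (simp add: algebra_simps)
  then have "\<rho> (total_cost v x a) \<le> \<rho> (\<lambda>w. total_cost u x a w + \<beta> * m)"
    using p by (intro \<rho>_mono total_cost_Lp Lp_space_add const_Lp wb xa AE_I2) (auto simp: add.assoc)
  then show ?thesis
    using v u xa by (simp add: \<rho>_shift total_cost_Lp wb \<rho>_total_cost)
qed

text \<open>Only the reference function \<open>u\<close> has to be increasing: \<open>v\<close> is
  first dominated by \<open>u + k * b\<close>, and then the risk of \<open>k * b\<close> splits off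
  by comonotonicity. The growth rate \<alpha> of \<open>b_hi\<close> carries over to
  \<open>b\<close> because \<open>- b_lo\<close> is nonnegative and \<alpha> is at least 1.\<close>

lemma next_risk_weighted:
  assumes v: "v \<in> measurable_values" and u: "u \<in> measurable_values" "mono u" and xa: "(x, a) \<in> D"
    and k: "0 \<le> k" and le: "\<And>y. v y \<le> u y + k * b y"
  shows "next_risk v x a \<le> next_risk u x a + \<alpha> * \<beta> * k * b x"
proof -
  note wb = v[THEN measurable_values_weight_bounded] u(1)[THEN measurable_values_weight_bounded]
  have b_mono: "mono b" and b_nonneg: "\<And>y. 0 \<le> b y"
    using b_hi_mono b_ge_1[THEN order_trans[OF zero_le_one]] by (auto simp: mono_def)
  have "\<rho> (\<lambda>w. b (T x a (Z w))) = \<rho> (\<lambda>w. b_hi (T x a (Z w))) + ereal (- b_lo)"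
    using \<rho>_shift[OF weight_bounded_Lp[OF weight_bounded_b_hi xa], of "- b_lo"] by simp
  also have "\<dots> \<le> ereal (\<alpha> * b_hi x) + ereal (- b_lo)"
    by (intro add_right_mono b_hi_growth xa)
  also have "\<dots> \<le> ereal (\<alpha> * b x)"
    using mult_right_mono_neg[OF \<alpha> b_lo] by (simp add: algebra_simps)
  finally have b_growth: "\<rho> (\<lambda>w. b (T x a (Z w))) \<le> ereal (\<alpha> * b x)" .
  have "\<rho> (total_cost v x a) \<le> \<rho> (total_cost (\<lambda>y. u y + k * b y) x a)"
    using le \<beta> by (intro \<rho>_mono total_cost_Lp wb weight_bounded_lin weight_bounded_b xa AE_I2) auto
  also have "\<dots> = \<rho> (total_cost u x a) + ereal (\<beta> * k) * \<rho> (\<lambda>w. b (T x a (Z w)))"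
    using measurable_values_bounds(1)[OF u(1)]
    by (intro \<rho>_total_cost_add[where m = lo] wb u weight_bounded_b b_mono b_nonneg k xa)
  also have "\<dots> \<le> \<rho> (total_cost u x a) + ereal (\<beta> * k) * ereal (\<alpha> * b x)"
    using \<beta> k b_growth by (intro add_left_mono ereal_mult_left_mono) auto
  also have "\<dots> = ereal (next_risk u x a + \<alpha> * \<beta> * k * b x)"
    by (simp add: \<rho>_total_cost[OF u(1) xa] mult_ac)
  finally show ?thesis by (simp add: \<rho>_total_cost[OF v xa])
qed

lemma next_risk_state_mono:
  assumes v: "v \<in> measurable_values" "mono v" and xa: "(x, a) \<in> D" and ya: "(y, a) \<in> D" and "x \<le> y"
  shows "next_risk v x a \<le> next_risk v y a"
proof -
  note wb = v(1)[THEN measurable_values_weight_bounded]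
  have "AE w in M. total_cost v x a w \<le> total_cost v y a w"
  proof (rule AE_I2)
    fix w assume "w \<in> space M"
    then have "T x a (Z w) \<le> T y a (Z w)"
      using assms by (intro T_incr Z_space)
    then show "total_cost v x a w \<le> total_cost v y a w"
      using assms \<beta> by (intro add_mono mult_left_mono c_incr monoD[OF v(2)]) auto
  qed
  then have "\<rho> (total_cost v x a) \<le> \<rho> (total_cost v y a)"
    by (intro \<rho>_mono total_cost_Lp wb xa ya)
  then show ?thesis using v xa ya by (simp add: \<rho>_total_cost)
qed

section \<open>Lower semicontinuity of the risk\<close>

text \<open>The next states need not converge, as \<open>T\<close> is merely lower semicontinuous.
  Capped at the limit state they do; semicontinuity of \<open>c\<close> and \<open>v\<close> is
  applied along the capped states, and monotonicity restores the true ones.\<close>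

lemma total_cost_lsc:
  assumes v: "v \<in> lsc_values" and xa: "(x, a) \<in> D" and D': "\<And>n. (xs n, as n) \<in> D"
    and xs: "xs \<longlonglongrightarrow> x" and as: "as \<longlonglongrightarrow> a" and w: "w \<in> space M"
    and y: "y < total_cost v x a w"
  shows "eventually (\<lambda>n. y < total_cost v (xs n) (as n) w) sequentially"
proof -
  let ?t = "T x a (Z w)" and ?tn = "\<lambda>n. T (xs n) (as n) (Z w)"
  let ?u = "\<lambda>n. min (?tn n) ?t"
  have pair: "(\<lambda>n. (xs n, as n)) \<longlonglongrightarrow> (x, a)"
    using xs as by (rule tendsto_Pair)
  have "eventually (\<lambda>n. r < ?tn n) sequentially" if "r < ?t" for r
    using lsc_on_eventually[OF T_lsc[OF Z_space[OF w]] xa D' pair] that by simp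
  then have u: "?u \<longlonglongrightarrow> ?t" by (rule min_tendstoI)
  \<comment> \<open>Half of the gap is allotted to \<open>c\<close> and half to
    \<open>\<beta> * v\<close>, hence \<open>\<delta> / \<beta>\<close> for \<open>v\<close>
    itself.\<close>
  define \<delta> where "\<delta> = (total_cost v x a w - y) / 2"
  have \<delta>: "0 < \<delta>" using y by (simp add: \<delta>_def)
  have "eventually (\<lambda>n. c x a ?t - \<delta> < c (xs n) (as n) (?u n)) sequentially"
    using lsc_on_eventually[OF c_lsc, of "((x, a), ?t)" "\<lambda>n. ((xs n, as n), ?u n)"]
      xa D' \<delta> tendsto_Pair[OF pair u] by simp
  moreover have "eventually (\<lambda>n. v ?t - \<delta> / \<beta> < v (?u n)) sequentially"
    using lsc_on_eventually[of UNIV v ?t ?u] v \<delta> \<beta> u by (simp add: lsc_values_def)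
  ultimately show ?thesis
  proof eventually_elim
    case (elim n)
    have "c (xs n) (as n) (?u n) \<le> c (xs n) (as n) (?tn n)"
      using D' by (intro c_incr) auto
    moreover have "v (?u n) \<le> v (?tn n)"
      by (intro monoD[OF lsc_values_mono[OF v]]) simp
    then have "\<beta> * (v ?t - \<delta> / \<beta>) < \<beta> * v (?tn n)"
      using elim(2) \<beta> by (intro mult_strict_left_mono) auto
    then have "\<beta> * v ?t - \<delta> < \<beta> * v (?tn n)"
      using \<beta> by (simp add: right_diff_distrib)
    ultimately show ?case
      using elim(1) y by (simp add: \<delta>_def field_simps)
  qed
qed

text \<open>The Fatou property is applied to the truncations of the approximating costs at the limit cost:
  by lower semicontinuity these converge, and they are dominated near the limit point.\<close>

lemma next_risk_lsc:
  assumes v: "v \<in> lsc_values" and xa: "(x, a) \<in> D" and D': "\<And>n. (xs n, as n) \<in> D"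
    and xs: "xs \<longlonglongrightarrow> x" and as: "as \<longlonglongrightarrow> a" and y: "y < next_risk v x a"
  shows "eventually (\<lambda>n. y < next_risk v (xs n) (as n)) sequentially"
proof -
  have vm: "v \<in> measurable_values" using v lsc_values_subset by blast
  note wb = measurable_values_weight_bounded[OF vm]
  obtain \<epsilon> \<Theta>1 \<Theta>2 where \<epsilon>: "0 < \<epsilon>"
    and \<Theta>L: "(\<lambda>w. \<Theta>1 (Z w)) \<in> Lp_space M p" "(\<lambda>w. \<Theta>2 (Z w)) \<in> Lp_space M p"
    and \<Theta>: "\<forall>z\<in>space MZ. \<forall>(x', a') \<in> D \<inter> cball (x, a) \<epsilon>.
       \<bar>c x' a' (T x' a' z)\<bar> \<le> \<Theta>1 z \<and> b (T x' a' z) \<le> \<Theta>2 z"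
    using integrability[OF xa] by blast
  have "(\<lambda>n. (xs n, as n)) \<longlonglongrightarrow> (x, a)" using xs as by (rule tendsto_Pair)
  then have "eventually (\<lambda>n. dist (xs n, as n) (x, a) < \<epsilon>) sequentially"
    using \<epsilon> by (rule tendstoD)
  then obtain N where N: "\<And>n. n \<ge> N \<Longrightarrow> dist (xs n, as n) (x, a) < \<epsilon>"
    by (auto simp: eventually_sequentially)
  \<comment> \<open>Domination is required for every index, hence the shift by \<open>N\<close> into
    the ball. The majorant \<open>Y\<close> comes from the bound \<open>\<kappa> * b\<close> on the
    absolute value of \<open>v\<close>.\<close>
  define G where "G n w = min (total_cost v (xs (n + N)) (as (n + N)) w) (total_cost v x a w)" for n w
  define Y where "Y w = \<Theta>1 (Z w) + \<beta> * \<kappa> * \<Theta>2 (Z w)" for w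
  have YL: "Y \<in> Lp_space M p"
    unfolding Y_def using p \<Theta>L by (intro Lp_space_add Lp_space_cmult) auto
  have bound: "\<bar>total_cost v x' a' w\<bar> \<le> Y w"
    if "(x', a') \<in> D \<inter> cball (x, a) \<epsilon>" "w \<in> space M" for x' a' w
  proof -
    let ?t = "T x' a' (Z w)"
    have le: "\<bar>c x' a' ?t\<bar> \<le> \<Theta>1 (Z w)" "b ?t \<le> \<Theta>2 (Z w)"
      using \<Theta> that Z_space by blast+
    have "\<bar>\<beta> * v ?t\<bar> \<le> \<beta> * (\<kappa> * b ?t)"
      using \<beta> measurable_values_abs_le[OF vm] by (auto simp: abs_mult intro!: mult_left_mono)
    also have "\<dots> \<le> \<beta> * (\<kappa> * \<Theta>2 (Z w))"
      using \<beta> \<kappa>_pos le by (intro mult_left_mono) auto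
    finally show ?thesis using le(1) by (simp add: Y_def algebra_simps)
  qed
  have G_le: "\<bar>G n w\<bar> \<le> Y w" if "w \<in> space M" for n w
  proof -
    have "(xs (n + N), as (n + N)) \<in> D \<inter> cball (x, a) \<epsilon>"
      using D' N[of "n + N"] by (simp add: dist_commute less_imp_le)
    moreover have "(x, a) \<in> D \<inter> cball (x, a) \<epsilon>" using xa \<epsilon> by simp
    ultimately show ?thesis
      using bound that unfolding G_def by (fastforce simp: min_def)
  qed
  have GL: "G n \<in> Lp_space M p" for n
  proof (rule Lp_space_dominated[OF _ _ YL])
    have "total_cost v (xs (n + N)) (as (n + N)) \<in> borel_measurable M"
      "total_cost v x a \<in> borel_measurable M"
      using total_cost_Lp[OF wb D'] total_cost_Lp[OF wb xa] by (auto simp: Lp_space_def)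
    then show "G n \<in> borel_measurable M"
      unfolding G_def by (auto intro: borel_measurable_min)
  qed (use p G_le in \<open>auto intro: order_trans[OF _ abs_ge_self]\<close>)
  have lim: "(\<lambda>n. G n w) \<longlonglongrightarrow> total_cost v x a w" if "w \<in> space M" for w
    unfolding G_def
  proof (rule min_tendstoI)
    fix r assume "r < total_cost v x a w"
    then show "eventually (\<lambda>n. r < total_cost v (xs (n + N)) (as (n + N)) w) sequentially"
      using total_cost_lsc[OF v xa D' xs as that]
      by (subst eventually_sequentially_seg[of "\<lambda>n. r < total_cost v (xs n) (as n) w"])
  qed
  have "\<rho> (total_cost v x a) \<le> liminf (\<lambda>n. \<rho> (G n))"
  proof (rule fatou[unfolded fatou_property_def, rule_format, of G "total_cost v x a" Y], intro conjI allI)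
    show "AE w in M. \<bar>G n w\<bar> \<le> Y w" for n using G_le by (rule AE_I2)
    show "AE w in M. (\<lambda>n. G n w) \<longlonglongrightarrow> total_cost v x a w" using lim by (rule AE_I2)
  qed (fact GL total_cost_Lp[OF wb xa] YL)+
  then have "ereal y < liminf (\<lambda>n. \<rho> (G n))"
    using y \<rho>_total_cost[OF vm xa] by (metis less_ereal.simps(1) order_less_le_trans)
  then have "eventually (\<lambda>n. ereal y < \<rho> (G n)) sequentially"
    by (rule less_LiminfD)
  then have "eventually (\<lambda>n. y < next_risk v (xs (n + N)) (as (n + N))) sequentially"
  proof eventually_elim
    case (elim n)
    also have "\<rho> (G n) \<le> \<rho> (total_cost v (xs (n + N)) (as (n + N)))"
      by (intro \<rho>_mono GL total_cost_Lp wb D' AE_I2) (simp add: G_def)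
    finally show ?case by (simp add: \<rho>_total_cost[OF vm D'])
  qed
  then show ?thesis
    by (subst (asm) eventually_sequentially_seg[of "\<lambda>n. y < next_risk v (xs n) (as n)"])
qed

section \<open>The Bellman operator\<close>

text \<open>With \<open>C = UNIV\<close> this becomes lower semicontinuity of the Bellman value;
  general closed \<open>C\<close> are what measurable selection asks for. Upper semicontinuity of
  the action sets supplies the limit action.\<close>

lemma closed_next_risk_hit:
  assumes v: "v \<in> lsc_values" and C: "closed C"
  shows "closed {x. \<exists>a\<in>D `` {x} \<inter> C. next_risk v x a \<le> r}"
  unfolding closed_sequential_limits
proof safe
  fix xs x assume "\<forall>n. xs n \<in> {x. \<exists>a\<in>D `` {x} \<inter> C. next_risk v x a \<le> r}" and xs: "xs \<longlonglongrightarrow> x"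
  then obtain as where as: "\<And>n. as n \<in> D `` {xs n} \<inter> C" "\<And>n. next_risk v (xs n) (as n) \<le> r"
    unfolding mem_Collect_eq Bex_def by metis
  then obtain a s where a: "a \<in> D `` {x}" and s: "strict_mono (s :: nat \<Rightarrow> nat)" "(as \<circ> s) \<longlonglongrightarrow> a"
    using D_usc[OF xs, of as] by auto
  have "a \<in> C"
    using C s(2) as(1) unfolding closed_sequential_limits by (metis IntD2 comp_apply)
  moreover have "next_risk v x a \<le> r"
  proof (rule ccontr)
    assume "\<not> next_risk v x a \<le> r"
    moreover have "(\<lambda>n. xs (s n)) \<longlonglongrightarrow> x" "(\<lambda>n. as (s n)) \<longlonglongrightarrow> a"
      using LIMSEQ_subseq_LIMSEQ[OF xs s(1)] s(2) by (simp_all add: comp_def)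
    ultimately have "eventually (\<lambda>n. r < next_risk v (xs (s n)) (as (s n))) sequentially"
      using a as(1) by (intro next_risk_lsc[OF v]) auto
    then obtain n where "r < next_risk v (xs (s n)) (as (s n))"
      by (auto dest: eventually_happens)
    with as(2)[of "s n"] show False by simp
  qed
  ultimately show "\<exists>a\<in>D `` {x} \<inter> C. next_risk v x a \<le> r" using a by blast
qed

lemma compact_next_risk_sublevel:
  assumes v: "v \<in> lsc_values"
  shows "compact {a\<in>D `` {x}. next_risk v x a \<le> r}"
  unfolding compact_eq_seq_compact_metric
proof (rule seq_compactI)
  fix as :: "nat \<Rightarrow> 'a" assume as: "\<forall>n. as n \<in> {a\<in>D `` {x}. next_risk v x a \<le> r}"
  \<comment> \<open>Upper semicontinuity is applied along the constant state sequence.\<close>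
  then obtain a s where a: "a \<in> D `` {x}" and s: "strict_mono (s :: nat \<Rightarrow> nat)" "(as \<circ> s) \<longlonglongrightarrow> a"
    using D_usc[of "\<lambda>_. x" x as] by auto
  have "next_risk v x a \<le> r"
  proof (rule ccontr)
    assume "\<not> next_risk v x a \<le> r"
    then have "eventually (\<lambda>n. r < next_risk v x (as (s n))) sequentially"
      using a as s(2) by (intro next_risk_lsc[OF v]) (auto simp: comp_def)
    then obtain n where "r < next_risk v x (as (s n))"
      by (auto dest: eventually_happens)
    with as show False by (auto simp: not_le[symmetric])
  qed
  with a s show "\<exists>l\<in>{a\<in>D `` {x}. next_risk v x a \<le> r}. \<exists>s. strict_mono (s :: nat \<Rightarrow> nat) \<and> (as \<circ> s) \<longlonglongrightarrow> l"
    by blast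
qed

definition bellman :: "(real \<Rightarrow> real) \<Rightarrow> real \<Rightarrow> real" where
  "bellman v x = (INF a\<in>D `` {x}. next_risk v x a)"

lemma bellman_le:
  assumes "v \<in> measurable_values" "(x, a) \<in> D"
  shows "bellman v x \<le> next_risk v x a"
  unfolding bellman_def
  using assms next_risk_ge_lo by (intro cINF_lower bdd_belowI2[where m = lo]) auto

lemma bellman_eqI:
  assumes "a \<in> argmin_set (next_risk v x) (D `` {x})"
  shows "bellman v x = next_risk v x a"
  unfolding bellman_def using assms
  by (intro cInf_eq_minimum) (auto simp: argmin_set_def)

lemma decision_rule_D: "d \<in> decision_rules A D \<Longrightarrow> (x, d x) \<in> D"
  by (simp add: decision_rules_def)

lemma bellman_attained:
  assumes v: "v \<in> lsc_values"
  obtains d where "d \<in> decision_rules A D" "\<And>x. bellman v x = next_risk v x (d x)"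
proof -
  let ?F = "\<lambda>x. argmin_set (next_risk v x) (D `` {x})"
  note compact = compact_next_risk_sublevel[OF v]
  have "\<exists>d \<in> borel_measurable borel. \<forall>x\<in>space borel. d x \<in> ?F x"
  proof (rule compact_measurable_selection)
    fix C :: "'a set" assume C: "closed C"
    show "{x \<in> space borel. ?F x \<inter> C \<noteq> {}} \<in> sets borel"
      using compact D_nonempty closed_next_risk_hit[OF v]
      by (intro argmin_set_hit_measurable C) (auto intro: borel_closed)
  qed (use argmin_set_compact[OF compact D_nonempty] in auto)
  then obtain d where d: "d \<in> borel_measurable borel" "\<And>x. d x \<in> ?F x" by auto
  then have dD: "(x, d x) \<in> D" for x by (auto simp: argmin_set_def)
  \<comment> \<open>\<open>D\<close> belongs to a product sigma-algebra over \<open>A\<close>, so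
    the actions occurring in it lie in \<open>A\<close>.\<close>
  then have "d x \<in> A" for x
    using sets.sets_into_space[OF D] by (auto simp: space_pair_measure space_restrict_space)
  then have "d \<in> decision_rules A D"
    using d(1) dD by (auto simp: decision_rules_def intro: measurable_restrict_space2)
  then show thesis using bellman_eqI[OF d(2)] by (rule that)
qed

lemma bellman_lsc_values:
  assumes v: "v \<in> lsc_values"
  shows "bellman v \<in> lsc_values"
proof -
  have vm: "v \<in> measurable_values" using v lsc_values_subset by blast
  obtain d where d: "d \<in> decision_rules A D" "\<And>x. bellman v x = next_risk v x (d x)"
    using bellman_attained[OF v] by blast
  note dD = decision_rule_D[OF d(1)]
  \<comment> \<open>As minima are attained, the sublevel sets of \<open>bellman v\<close> are
    exactly the sets already known to be closed.\<close>
  have "bellman v x \<le> r \<longleftrightarrow> (\<exists>a\<in>D `` {x} \<inter> UNIV. next_risk v x a \<le> r)" for x r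
    using d(2)[of x] dD[of x] bellman_le[OF vm] by (force intro: order_trans)
  then have "lsc_on UNIV (bellman v)"
    using closed_next_risk_hit[OF v closed_UNIV] by (intro lsc_on_UNIV_I) simp
  moreover have "mono (bellman v)"
  proof (rule monoI)
    fix x y :: real assume xy: "x \<le> y"
    \<comment> \<open>Action sets shrink as the state grows, so the minimiser at \<open>y\<close> is
      still admissible at \<open>x\<close>.\<close>
    then have xd: "(x, d y) \<in> D" using D_decr[OF xy] dD[of y] by auto
    then have "bellman v x \<le> next_risk v x (d y)" by (rule bellman_le[OF vm])
    also have "\<dots> \<le> next_risk v y (d y)"
      by (rule next_risk_state_mono[OF vm lsc_values_mono[OF v] xd dD xy])
    finally show "bellman v x \<le> bellman v y" by (simp add: d(2))
  qed
  ultimately show ?thesis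
    unfolding lsc_values_def using next_risk_ge_lo[OF vm dD] next_risk_le_hi[OF vm dD] d(2) by simp
qed

lemma bellman_weighted:
  assumes v: "v \<in> lsc_values" and u: "u \<in> lsc_values"
    and k: "0 \<le> k" and le: "\<And>y. v y \<le> u y + k * b y"
  shows "bellman v x \<le> bellman u x + \<alpha> * \<beta> * k * b x"
proof -
  obtain d where d: "d \<in> decision_rules A D" "\<And>x. bellman u x = next_risk u x (d x)"
    using bellman_attained[OF u] by blast
  have "bellman v x \<le> next_risk v x (d x)"
    using v lsc_values_subset decision_rule_D[OF d(1)] by (intro bellman_le) auto
  also have "\<dots> \<le> next_risk u x (d x) + \<alpha> * \<beta> * k * b x"
    using v u lsc_values_subset decision_rule_D[OF d(1)] lsc_values_mono
    by (intro next_risk_weighted k le) auto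
  finally show ?thesis by (simp add: d(2))
qed

section \<open>Convergence of the Bellman iterates and the fixed point\<close>

abbreviation bellman_iter :: "nat \<Rightarrow> (real \<Rightarrow> real) \<Rightarrow> real \<Rightarrow> real" where
  "bellman_iter n \<equiv> bellman ^^ n"

lemma bellman_iter_lsc_values: "v \<in> lsc_values \<Longrightarrow> bellman_iter n v \<in> lsc_values"
  by (induction n) (simp_all add: bellman_lsc_values)

text \<open>Any two functions between \<open>lo\<close> and \<open>hi\<close> differ by at most
  \<open>\<kappa> * b\<close>, so the geometric rate has a starting constant independent of them.
  Convergence, uniqueness and finiteness of the weighted norm all rest on this.\<close>

lemma bellman_iter_close:
  assumes v: "v \<in> lsc_values" and u: "u \<in> lsc_values"
  shows "\<bar>bellman_iter n v x - bellman_iter n u x\<bar> \<le> (\<alpha> * \<beta>) ^ n * \<kappa> * b x"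
proof -
  have "bellman_iter n v x \<le> bellman_iter n u x + (\<alpha> * \<beta>) ^ n * \<kappa> * b x"
    if "v \<in> lsc_values" "u \<in> lsc_values" for v u
  proof (induction n arbitrary: x)
    case 0
    show ?case using measurable_values_diff[of v u x] that lsc_values_subset by auto
  next
    case (Suc n)
    have "bellman (bellman_iter n v) x \<le>
        bellman (bellman_iter n u) x + \<alpha> * \<beta> * ((\<alpha> * \<beta>) ^ n * \<kappa>) * b x"
      using that \<alpha> \<beta> \<kappa>_pos Suc by (intro bellman_weighted bellman_iter_lsc_values) auto
    then show ?case by (simp add: mult_ac)
  qed
  from this[OF v u] this[OF u v] show ?thesis by (simp add: abs_le_iff)
qed

lemma modulus: "0 < \<alpha> * \<beta>" "(\<lambda>n. (\<alpha> * \<beta>) ^ n * k) \<longlonglongrightarrow> 0"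
proof -
  show pos: "0 < \<alpha> * \<beta>" using \<alpha> \<beta> by simp
  have "(\<lambda>n. (\<alpha> * \<beta>) ^ n) \<longlonglongrightarrow> 0"
    using pos discounting by (intro LIMSEQ_power_zero) auto
  then show "(\<lambda>n. (\<alpha> * \<beta>) ^ n * k) \<longlonglongrightarrow> 0" by (rule tendsto_mult_left_zero)
qed

definition value_limit :: "real \<Rightarrow> real" where
  "value_limit x = lim (\<lambda>n. bellman_iter n (\<lambda>_. 0) x)"

lemma value_limit_tendsto: "(\<lambda>n. bellman_iter n (\<lambda>_. 0) x) \<longlonglongrightarrow> value_limit x"
proof -
  have "Cauchy (\<lambda>n. bellman_iter n (\<lambda>_. 0) x)"
  proof (rule CauchyI')
    fix e :: real assume "0 < e"
    then have "eventually (\<lambda>n. (\<alpha> * \<beta>) ^ n * (\<kappa> * b x) < e) sequentially"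
      using modulus(2) by (rule order_tendstoD(2)[rotated])
    then obtain N where N: "\<And>n. n \<ge> N \<Longrightarrow> (\<alpha> * \<beta>) ^ n * (\<kappa> * b x) < e"
      by (auto simp: eventually_sequentially)
    have "dist (bellman_iter m (\<lambda>_. 0) x) (bellman_iter n (\<lambda>_. 0) x) < e" if "m \<ge> N" "m < n" for m n
    proof -
      \<comment> \<open>Both iterates are \<open>m\<close>-fold images, one of 0 and the other of a
        later iterate.\<close>
      have "bellman_iter n (\<lambda>_. 0) = bellman_iter m (bellman_iter (n - m) (\<lambda>_. 0))"
        using that by (simp flip: funpow_add comp_apply[of "bellman_iter m"])
      then have "dist (bellman_iter m (\<lambda>_. 0) x) (bellman_iter n (\<lambda>_. 0) x) \<le> (\<alpha> * \<beta>) ^ m * \<kappa> * b x"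
        using bellman_iter_close zero_in_lsc_values bellman_iter_lsc_values by (simp add: dist_real_def)
      with N[OF that(1)] show ?thesis by (simp add: mult.assoc)
    qed
    then show "\<exists>N. \<forall>m\<ge>N. \<forall>n>m. dist (bellman_iter m (\<lambda>_. 0) x) (bellman_iter n (\<lambda>_. 0) x) < e"
      by blast
  qed
  then show ?thesis
    unfolding value_limit_def by (simp add: Cauchy_convergent_iff convergent_LIMSEQ_iff)
qed

lemma value_limit_close:
  "\<bar>bellman_iter n (\<lambda>_. 0) x - value_limit x\<bar> \<le> (\<alpha> * \<beta>) ^ n * \<kappa> * b x"
proof (rule LIMSEQ_le_const2)
  show "(\<lambda>k. \<bar>bellman_iter n (\<lambda>_. 0) x - bellman_iter (k + n) (\<lambda>_. 0) x\<bar>)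
      \<longlonglongrightarrow> \<bar>bellman_iter n (\<lambda>_. 0) x - value_limit x\<bar>"
    by (intro tendsto_intros LIMSEQ_ignore_initial_segment value_limit_tendsto)
  have "bellman_iter (k + n) (\<lambda>_. 0) = bellman_iter n (bellman_iter k (\<lambda>_. 0))" for k
    by (simp add: add.commute[of k] funpow_add)
  then show "\<exists>N. \<forall>k\<ge>N. \<bar>bellman_iter n (\<lambda>_. 0) x - bellman_iter (k + n) (\<lambda>_. 0) x\<bar>
      \<le> (\<alpha> * \<beta>) ^ n * \<kappa> * b x"
    using bellman_iter_close[OF zero_in_lsc_values bellman_iter_lsc_values[OF zero_in_lsc_values]]
    by simp
qed

text \<open>As \<open>b\<close> is increasing, the convergence to the limit is uniform on half-lines, which
  preserves lower semicontinuity.\<close>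

lemma value_limit_lsc_values: "value_limit \<in> lsc_values"
proof -
  let ?B = "\<lambda>n. bellman_iter n (\<lambda>_. 0)"
  have B: "?B n \<in> lsc_values" for n by (rule bellman_iter_lsc_values[OF zero_in_lsc_values])
  then have Bb: "lo \<le> ?B n x" "?B n x \<le> hi x" for n x by (auto simp: lsc_values_def)
  have "lsc_on UNIV value_limit"
    unfolding lsc_on_def
  proof (intro ballI allI impI)
    fix x y assume y: "y < value_limit x"
    \<comment> \<open>The half-line below \<open>x + 1\<close> contains a neighbourhood of
      \<open>x\<close>, and \<open>b (x + 1)\<close> bounds the weight on it.\<close>
    let ?e = "\<lambda>n. (\<alpha> * \<beta>) ^ n * (\<kappa> * b (x + 1))"
    have "(\<lambda>n. ?B n x - ?e n) \<longlonglongrightarrow> value_limit x - 0"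
      by (intro tendsto_diff value_limit_tendsto modulus)
    with y have "eventually (\<lambda>n. y < ?B n x - ?e n) sequentially"
      by (auto dest: order_tendstoD(1))
    then obtain n where "y < ?B n x - ?e n"
      by (auto dest: eventually_happens)
    then have "y + ?e n < ?B n x" by simp
    then have "eventually (\<lambda>x'. y + ?e n < ?B n x') (at x within UNIV)"
      using B[of n] by (simp add: lsc_values_def lsc_on_def)
    moreover have "eventually (\<lambda>x'. x' < x + 1) (at x within UNIV)"
      using order_tendstoD(2)[OF tendsto_ident_at, of x "x + 1"] by simp
    ultimately show "eventually (\<lambda>x'. y < value_limit x') (at x within UNIV)"
    proof eventually_elim
      case (elim x')
      have "(\<alpha> * \<beta>) ^ n * \<kappa> * b x' \<le> (\<alpha> * \<beta>) ^ n * \<kappa> * b (x + 1)"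
        using elim(2) monoD[OF b_hi_mono, of x' "x + 1"] modulus(1) \<kappa>_pos
        by (intro mult_left_mono) auto
      with elim(1) value_limit_close[of n x'] show ?case by (simp add: mult.assoc abs_le_iff)
    qed
  qed
  moreover have "mono value_limit"
    using monoD[OF lsc_values_mono[OF B]]
    by (intro monoI LIMSEQ_le[OF value_limit_tendsto value_limit_tendsto]) auto
  moreover have "lo \<le> value_limit x" "value_limit x \<le> hi x" for x
    using Bb by (auto intro: LIMSEQ_le_const[OF value_limit_tendsto] LIMSEQ_le_const2[OF value_limit_tendsto])
  ultimately show ?thesis by (simp add: lsc_values_def)
qed

text \<open>The weighted estimate makes \<open>bellman\<close> continuous along the iterates, so the
  limit can be exchanged with the operator.\<close>

lemma bellman_value_limit: "bellman value_limit = value_limit"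
proof
  fix x
  let ?B = "\<lambda>n. bellman_iter n (\<lambda>_. 0)"
  have B: "?B n \<in> lsc_values" for n by (rule bellman_iter_lsc_values[OF zero_in_lsc_values])
  have pos: "0 \<le> (\<alpha> * \<beta>) ^ n * \<kappa>" for n using modulus(1) \<kappa>_pos by simp
  have "\<bar>?B (Suc n) x - bellman value_limit x\<bar> \<le> (\<alpha> * \<beta>) ^ n * (\<alpha> * \<beta> * \<kappa> * b x)" for n
  proof -
    have le: "?B n y \<le> value_limit y + (\<alpha> * \<beta>) ^ n * \<kappa> * b y"
      "value_limit y \<le> ?B n y + (\<alpha> * \<beta>) ^ n * \<kappa> * b y" for y
      using value_limit_close[of n y] by (auto simp: abs_le_iff)
    show ?thesis
      using bellman_weighted[OF B value_limit_lsc_values pos le(1), of x]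
        bellman_weighted[OF value_limit_lsc_values B pos le(2), of x]
      by (simp add: abs_le_iff mult_ac)
  qed
  then have "(\<lambda>n. ?B (Suc n) x - bellman value_limit x) \<longlonglongrightarrow> 0"
    by (intro Lim_null_comparison[OF _ modulus(2)] always_eventually) auto
  then have "(\<lambda>n. ?B (Suc n) x) \<longlonglongrightarrow> bellman value_limit x"
    by (simp only: LIM_zero_iff)
  then show "bellman value_limit x = value_limit x"
    by (rule LIMSEQ_unique[OF _ LIMSEQ_Suc[OF value_limit_tendsto]])
qed

lemma bellman_fixed_point_unique:
  assumes v: "v \<in> lsc_values" and fixed: "bellman v = v"
  shows "v = value_limit"
proof
  fix x
  have iter: "bellman_iter n v = v" for n by (induction n) (simp_all add: fixed)
  have "(\<lambda>n. bellman_iter n (\<lambda>_. 0) x - v x) \<longlonglongrightarrow> 0"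
    using bellman_iter_close[OF zero_in_lsc_values v, of _ x]
    by (intro Lim_null_comparison[OF _ modulus(2)[of "\<kappa> * b x"]] always_eventually)
      (simp add: iter mult.assoc)
  then have "(\<lambda>n. bellman_iter n (\<lambda>_. 0) x) \<longlonglongrightarrow> v x"
    by (simp only: LIM_zero_iff)
  with value_limit_tendsto show "v x = value_limit x" by (rule LIMSEQ_unique[rotated])
qed

section \<open>Policy values\<close>

abbreviation policies :: "(nat \<Rightarrow> real \<Rightarrow> 'a) set" where
  "policies \<equiv> markov_policies A D"

lemma policies_Suc: "\<pi> \<in> policies \<Longrightarrow> (\<lambda>n. \<pi> (Suc n)) \<in> policies"
  and policies_D: "\<pi> \<in> policies \<Longrightarrow> (x, \<pi> n x) \<in> D"
  by (auto simp: markov_policies_def decision_rules_def)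

lemma policy_value_0: "policy_value \<rho> T Z c \<beta> 0 \<pi> = (\<lambda>_. 0)"
  by (simp add: policy_value_def)

text \<open>The first rule is outermost, so the recursion passes to the policy shifted by one stage;
  inductions on the horizon therefore let the policy vary.\<close>

lemma policy_value_Suc:
  "policy_value \<rho> T Z c \<beta> (Suc N) \<pi> =
     policy_op \<rho> T Z c \<beta> (\<pi> 0) (policy_value \<rho> T Z c \<beta> N (\<lambda>n. \<pi> (Suc n)))"
proof -
  have "[0..<Suc N] = 0 # map Suc [0..<N]"
    by (metis map_Suc_upt upt_conv_Cons zero_less_Suc)
  then show ?thesis by (simp only: policy_value_def foldr_map foldr.simps comp_def)
qed

lemma stage_risk_eq:
  assumes "v \<in> measurable_values" "(x, a) \<in> D"
  shows "stage_risk \<rho> T Z c \<beta> (\<lambda>x. ereal (v x)) x a = ereal (next_risk v x a)"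
  using \<rho>_total_cost[OF assms] by (simp add: stage_risk_def)

definition policy_return :: "nat \<Rightarrow> (nat \<Rightarrow> real \<Rightarrow> 'a) \<Rightarrow> real \<Rightarrow> real" where
  "policy_return N \<pi> x = real_of_ereal (policy_value \<rho> T Z c \<beta> N \<pi> x)"

lemma policy_return:
  assumes "\<pi> \<in> policies"
  shows "policy_return N \<pi> \<in> measurable_values"
    and "policy_value \<rho> T Z c \<beta> N \<pi> = (\<lambda>x. ereal (policy_return N \<pi> x))"
proof -
  have "policy_return N \<pi> \<in> measurable_values \<and>
      policy_value \<rho> T Z c \<beta> N \<pi> = (\<lambda>x. ereal (policy_return N \<pi> x))"
    using assms
  proof (induction N arbitrary: \<pi>)
    case 0
    then show ?case
      using zero_in_lsc_values lsc_values_subset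
      by (auto simp: policy_return_def[abs_def] policy_value_0)
  next
    case (Suc N)
    let ?v = "policy_return N (\<lambda>n. \<pi> (Suc n))"
    have v: "?v \<in> measurable_values"
      and eq: "policy_value \<rho> T Z c \<beta> N (\<lambda>n. \<pi> (Suc n)) = (\<lambda>x. ereal (?v x))"
      using Suc.IH policies_Suc[OF Suc.prems] by auto
    note xd = policies_D[OF Suc.prems]
    have val: "policy_value \<rho> T Z c \<beta> (Suc N) \<pi> = (\<lambda>x. ereal (next_risk ?v x (\<pi> 0 x)))"
      by (simp add: fun_eq_iff policy_value_Suc policy_op_def eq stage_risk_eq[OF v xd])
    then have ret: "policy_return (Suc N) \<pi> = (\<lambda>x. next_risk ?v x (\<pi> 0 x))"
      by (simp add: fun_eq_iff policy_return_def)
    \<comment> \<open>Measurability is the standing assumption on policy values; only the bounds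
      come from the recursion.\<close>
    have "policy_return (Suc N) \<pi> \<in> borel_measurable borel"
      unfolding policy_return_def[abs_def]
      using policy_value_measurable[OF Suc.prems] by measurable
    then show ?case
      using next_risk_ge_lo[OF v xd] next_risk_le_hi[OF v xd] val ret
      by (simp add: measurable_values_def)
  qed
  then show "policy_return N \<pi> \<in> measurable_values"
    and "policy_value \<rho> T Z c \<beta> N \<pi> = (\<lambda>x. ereal (policy_return N \<pi> x))" by auto
qed

lemma policy_return_0: "policy_return 0 \<pi> x = 0"
  by (simp add: policy_return_def policy_value_0)

lemma policy_return_Suc:
  assumes \<pi>: "\<pi> \<in> policies"
  shows "policy_return (Suc N) \<pi> x = next_risk (policy_return N (\<lambda>n. \<pi> (Suc n))) x (\<pi> 0 x)"
  using policy_return[OF policies_Suc[OF \<pi>], of N] stage_risk_eq policies_D[OF \<pi>]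
  by (simp add: policy_return_def[of "Suc N"] policy_value_Suc policy_op_def)

text \<open>For \<open>N = 0\<close> this is the lower bound on the risk of one stage. Each stage
  put in front carries the constant through \<rho> and discounts it once more.\<close>

lemma policy_return_step:
  "\<pi> \<in> policies \<Longrightarrow> policy_return N \<pi> x \<le> policy_return (Suc N) \<pi> x - \<beta> ^ N * b_lo"
proof (induction N arbitrary: \<pi> x)
  case 0
  then show ?case
    using next_risk_ge[OF policy_return(1), of _ 0 0] policies_Suc policies_D
    by (simp add: policy_return_Suc policy_return_0)
next
  case (Suc N)
  let ?\<pi> = "\<lambda>n. \<pi> (Suc n)"
  have \<pi>: "?\<pi> \<in> policies" by (rule policies_Suc[OF Suc.prems])
  have "next_risk (policy_return N ?\<pi>) x (\<pi> 0 x) \<le>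
      next_risk (policy_return (Suc N) ?\<pi>) x (\<pi> 0 x) + \<beta> * (- (\<beta> ^ N * b_lo))"
    using Suc.IH[OF \<pi>] by (intro next_risk_shift policy_return \<pi> policies_D Suc.prems) simp
  then show ?case by (simp add: policy_return_Suc[OF Suc.prems])
qed

text \<open>The correction \<open>\<beta> ^ N * (b_lo / (1 - \<beta>))\<close> is the accumulated lower bound of all
  costs after stage \<open>N\<close>. Adding it makes the policy values increasing in \<open>N\<close>.\<close>

lemma policy_return_convergent:
  assumes \<pi>: "\<pi> \<in> policies"
  shows "convergent (\<lambda>N. policy_return N \<pi> x)"
proof -
  define r where "r = b_lo / (1 - \<beta>)"
  let ?u = "\<lambda>N. policy_return N \<pi> x + \<beta> ^ N * r"
  have "b_lo = (1 - \<beta>) * r" using \<beta>_less_1 by (simp add: r_def)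
  \<comment> \<open>By this equation the one-step defect \<open>\<beta> ^ N * b_lo\<close> is
    exactly the difference of consecutive corrections.\<close>
  then have r: "b_lo = r - \<beta> * r" by (simp add: algebra_simps)
  have "r \<le> 0" using \<beta>_less_1 b_lo by (simp add: r_def divide_le_0_iff)
  have "?u N \<le> ?u (Suc N)" for N
    using policy_return_step[OF \<pi>, of N x] by (simp add: r algebra_simps)
  then have "incseq ?u" by (rule incseq_SucI)
  moreover have "?u N \<le> hi x" for N
    using measurable_values_bounds(2)[OF policy_return(1)[OF \<pi>], of N x] \<open>r \<le> 0\<close> \<beta>
      mult_nonneg_nonpos[of "\<beta> ^ N" r] by simp
  ultimately obtain L where "?u \<longlonglongrightarrow> L"
    using incseq_convergent[of ?u "hi x"] by blast
  moreover have "(\<lambda>N. \<beta> ^ N * r) \<longlonglongrightarrow> 0"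
    using \<beta> \<beta>_less_1 by (intro tendsto_mult_left_zero LIMSEQ_power_zero) auto
  ultimately have "(\<lambda>N. ?u N - \<beta> ^ N * r) \<longlonglongrightarrow> L - 0"
    by (rule tendsto_diff)
  then show ?thesis by (auto simp: convergent_def)
qed

lemma bellman_iter_le_policy_return:
  "\<pi> \<in> policies \<Longrightarrow> bellman_iter N (\<lambda>_. 0) x \<le> policy_return N \<pi> x"
proof (induction N arbitrary: \<pi> x)
  case (Suc N)
  let ?B = "bellman_iter N (\<lambda>_. 0)"
  have B: "?B \<in> measurable_values"
    using bellman_iter_lsc_values[OF zero_in_lsc_values] lsc_values_subset by blast
  note xd = policies_D[OF Suc.prems] and \<pi> = policies_Suc[OF Suc.prems]
  have "bellman ?B x \<le> next_risk ?B x (\<pi> 0 x)"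
    by (rule bellman_le[OF B xd])
  also have "\<dots> \<le> next_risk (policy_return N (\<lambda>n. \<pi> (Suc n))) x (\<pi> 0 x) + \<beta> * 0"
    using Suc.IH[OF \<pi>] by (intro next_risk_shift B policy_return \<pi> xd) simp
  finally show ?case by (simp add: policy_return_Suc[OF Suc.prems])
qed (simp add: policy_return_0)

text \<open>A policy attaining the iterate for horizon \<open>N + 1\<close> starts with a minimiser
  for the \<open>N\<close>-th iterate and continues with a policy attaining that one. The rules
  therefore depend on the horizon.\<close>

lemma bellman_iter_attained:
  "\<exists>\<pi>\<in>policies. policy_return N \<pi> = bellman_iter N (\<lambda>_. 0)"
proof (induction N)
  case 0
  obtain d where "d \<in> decision_rules A D"
    using bellman_attained[OF zero_in_lsc_values] by blast
  then have "(\<lambda>_. d) \<in> policies" by (simp add: markov_policies_def)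
  then show ?case by (intro bexI) (auto simp: policy_return_0)
next
  case (Suc N)
  let ?B = "bellman_iter N (\<lambda>_. 0)"
  obtain \<pi> where \<pi>: "\<pi> \<in> policies" "policy_return N \<pi> = ?B" using Suc by blast
  obtain d where d: "d \<in> decision_rules A D" "\<And>x. bellman ?B x = next_risk ?B x (d x)"
    using bellman_attained[OF bellman_iter_lsc_values[OF zero_in_lsc_values]] by blast
  have mem: "case_nat d \<pi> \<in> policies"
    using \<pi>(1) d(1) by (auto simp: markov_policies_def split: nat.split)
  have "policy_return (Suc N) (case_nat d \<pi>) = bellman_iter (Suc N) (\<lambda>_. 0)"
    by (simp add: fun_eq_iff policy_return_Suc[OF mem] \<pi>(2) d(2))
  with mem show ?case by blast
qed

lemma INF_policy_value:
  "(INF \<pi>\<in>policies. policy_value \<rho> T Z c \<beta> N \<pi> x) = ereal (bellman_iter N (\<lambda>_. 0) x)"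
proof (rule antisym)
  obtain \<pi> where "\<pi> \<in> policies" "policy_return N \<pi> = bellman_iter N (\<lambda>_. 0)"
    using bellman_iter_attained by blast
  then show "(INF \<pi>\<in>policies. policy_value \<rho> T Z c \<beta> N \<pi> x) \<le> ereal (bellman_iter N (\<lambda>_. 0) x)"
    using policy_return(2) by (intro INF_lower2[of \<pi>]) auto
  show "ereal (bellman_iter N (\<lambda>_. 0) x) \<le> (INF \<pi>\<in>policies. policy_value \<rho> T Z c \<beta> N \<pi> x)"
    using bellman_iter_le_policy_return policy_return(2) by (intro INF_greatest) simp
qed

definition policy_limit :: "(nat \<Rightarrow> real \<Rightarrow> 'a) \<Rightarrow> real \<Rightarrow> real" where
  "policy_limit \<pi> x = lim (\<lambda>N. policy_return N \<pi> x)"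

lemma policy_limit_tendsto: "\<pi> \<in> policies \<Longrightarrow> (\<lambda>N. policy_return N \<pi> x) \<longlonglongrightarrow> policy_limit \<pi> x"
  using policy_return_convergent unfolding policy_limit_def by (simp add: convergent_LIMSEQ_iff)

lemma lim_policy_value:
  assumes "\<pi> \<in> policies"
  shows "(\<lambda>N. policy_value \<rho> T Z c \<beta> N \<pi> x) \<longlonglongrightarrow> ereal (policy_limit \<pi> x)"
    and "lim (\<lambda>N. policy_value \<rho> T Z c \<beta> N \<pi> x) = ereal (policy_limit \<pi> x)"
proof -
  show lim: "(\<lambda>N. policy_value \<rho> T Z c \<beta> N \<pi> x) \<longlonglongrightarrow> ereal (policy_limit \<pi> x)"
    using policy_limit_tendsto[OF assms] by (simp add: policy_return(2)[OF assms])
  show "lim (\<lambda>N. policy_value \<rho> T Z c \<beta> N \<pi> x) = ereal (policy_limit \<pi> x)"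
    by (rule limI[OF lim])
qed

lemma policy_limit_bounds:
  assumes "\<pi> \<in> policies"
  shows "lo \<le> policy_limit \<pi> x" "policy_limit \<pi> x \<le> hi x"
  using measurable_values_bounds[OF policy_return(1)[OF assms]]
  by (auto intro: LIMSEQ_le_const[OF policy_limit_tendsto[OF assms]]
      LIMSEQ_le_const2[OF policy_limit_tendsto[OF assms]])

lemma value_limit_le_policy_limit:
  assumes "\<pi> \<in> policies"
  shows "value_limit x \<le> policy_limit \<pi> x"
  using bellman_iter_le_policy_return[OF assms]
  by (intro LIMSEQ_le[OF value_limit_tendsto policy_limit_tendsto[OF assms]]) auto

text \<open>The intermediate values of a stationary policy need not be increasing in the state, so the
  contraction estimate is not available for them. Translation invariance suffices for the upper
  bound.\<close>

lemma stationary_optimal: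
  assumes d: "d \<in> decision_rules A D" and greedy: "\<And>x. next_risk value_limit x (d x) = value_limit x"
  shows "policy_limit (\<lambda>_. d) x = value_limit x"
proof (rule antisym)
  have \<pi>: "(\<lambda>_. d) \<in> policies" using d by (simp add: markov_policies_def)
  have V: "value_limit \<in> measurable_values"
    using value_limit_lsc_values lsc_values_subset by blast
  \<comment> \<open>The initial error \<open>- lo\<close> is a constant because the limit is bounded
    below by \<open>lo\<close>; each greedy stage discounts it by \<open>\<beta>\<close>.\<close>
  have "policy_return N (\<lambda>_. d) x \<le> value_limit x + \<beta> ^ N * (- lo)" for N x
  proof (induction N arbitrary: x)
    case 0
    show ?case using measurable_values_bounds(1)[OF V, of x] by (simp add: policy_return_0)
  next
    case (Suc N)
    have "next_risk (policy_return N (\<lambda>_. d)) x (d x) \<le>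
        next_risk value_limit x (d x) + \<beta> * (\<beta> ^ N * (- lo))"
      by (intro next_risk_shift policy_return \<pi> V decision_rule_D[OF d] Suc)
    then show ?case by (simp add: policy_return_Suc[OF \<pi>] greedy mult.assoc)
  qed
  moreover have "(\<lambda>N. value_limit x + \<beta> ^ N * (- lo)) \<longlonglongrightarrow> value_limit x + 0"
    using \<beta> \<beta>_less_1 by (intro tendsto_intros tendsto_mult_left_zero LIMSEQ_power_zero) auto
  ultimately show "policy_limit (\<lambda>_. d) x \<le> value_limit x"
    using LIMSEQ_le[OF policy_limit_tendsto[OF \<pi>]] by simp
  show "value_limit x \<le> policy_limit (\<lambda>_. d) x"
    by (rule value_limit_le_policy_limit[OF \<pi>])
qed

section \<open>Extended real valued operators\<close>

lemma value_classI_eq: "value_classI lo hi = (\<lambda>v x. ereal (v x)) ` lsc_values"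
  by (auto simp: value_classI_def lsc_values_def)

lemma bellman_op_eq:
  assumes v: "v \<in> lsc_values"
  shows "bellman_op \<rho> T Z c \<beta> D (\<lambda>x. ereal (v x)) = (\<lambda>x. ereal (bellman v x))"
proof
  fix x
  have vm: "v \<in> measurable_values" using v lsc_values_subset by blast
  obtain d where d: "d \<in> decision_rules A D" "\<And>x. bellman v x = next_risk v x (d x)"
    using bellman_attained[OF v] by blast
  show "bellman_op \<rho> T Z c \<beta> D (\<lambda>x. ereal (v x)) x = ereal (bellman v x)"
    unfolding bellman_op_def
  proof (rule antisym)
    show "(INF a\<in>D `` {x}. stage_risk \<rho> T Z c \<beta> (\<lambda>x. ereal (v x)) x a) \<le> ereal (bellman v x)"
      using decision_rule_D[OF d(1), of x]
      by (intro INF_lower2[of "d x"]) (auto simp: stage_risk_eq[OF vm] d(2))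
    show "ereal (bellman v x) \<le> (INF a\<in>D `` {x}. stage_risk \<rho> T Z c \<beta> (\<lambda>x. ereal (v x)) x a)"
      using bellman_le[OF vm] by (intro INF_greatest) (auto simp: stage_risk_eq[OF vm])
  qed
qed

lemma policy_op_eq:
  assumes "v \<in> lsc_values" "d \<in> decision_rules A D"
  shows "policy_op \<rho> T Z c \<beta> d (\<lambda>x. ereal (v x)) = (\<lambda>x. ereal (next_risk v x (d x)))"
  using assms lsc_values_subset decision_rule_D[OF assms(2)]
  by (auto simp: policy_op_def fun_eq_iff intro!: stage_risk_eq)

lemma weighted_norm_le_iff:
  "weighted_norm b (\<lambda>x. ereal (f x)) \<le> ereal k \<longleftrightarrow> (\<forall>x. \<bar>f x\<bar> \<le> k * b x)"
proof -
  have "\<bar>ereal (f x)\<bar> / ereal (b x) \<le> ereal k \<longleftrightarrow> \<bar>f x\<bar> \<le> k * b x" for x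
  proof -
    have "0 < b x" using b_ge_1[of x] by linarith
    moreover from this have "\<bar>ereal (f x)\<bar> / ereal (b x) = ereal (\<bar>f x\<bar> / b x)" by simp
    ultimately show ?thesis by (simp only: ereal_less_eq pos_divide_le_eq)
  qed
  then show ?thesis unfolding weighted_norm_def SUP_le_iff by simp
qed

lemma bellman_contraction:
  assumes v: "v \<in> lsc_values" and u: "u \<in> lsc_values"
  shows "weighted_norm b (\<lambda>x. ereal (bellman v x - bellman u x)) \<le>
    ereal (\<alpha> * \<beta>) * weighted_norm b (\<lambda>x. ereal (v x - u x))"
proof -
  let ?n = "weighted_norm b (\<lambda>x. ereal (v x - u x))"
  \<comment> \<open>Finiteness of the norm, from the iteration estimate for zero iterates, allows it
    to be used as a real factor \<open>k\<close>.\<close>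
  have "?n \<le> ereal \<kappa>"
    unfolding weighted_norm_le_iff using bellman_iter_close[OF v u, of 0] by simp
  moreover have "0 \<le> ?n"
    unfolding weighted_norm_def
    using b_ge_1[of 0] by (intro SUP_upper2[of 0]) auto
  ultimately obtain k where k: "?n = ereal k" "0 \<le> k" by (cases ?n) auto
  then have le: "\<bar>v x - u x\<bar> \<le> k * b x" for x
    using weighted_norm_le_iff[of "\<lambda>x. v x - u x" k] by simp
  have "v x \<le> u x + k * b x" "u x \<le> v x + k * b x" for x
    using le[of x] by (auto simp: abs_le_iff)
  then have "bellman v x \<le> bellman u x + \<alpha> * \<beta> * k * b x" "bellman u x \<le> bellman v x + \<alpha> * \<beta> * k * b x" for x
    using bellman_weighted[OF v u k(2)] bellman_weighted[OF u v k(2)] by blast+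
  then have "\<bar>bellman v x - bellman u x\<bar> \<le> \<alpha> * \<beta> * k * b x" for x
    unfolding abs_le_iff by (smt (verit))
  then have "weighted_norm b (\<lambda>x. ereal (bellman v x - bellman u x)) \<le> ereal (\<alpha> * \<beta> * k)"
    by (simp add: weighted_norm_le_iff)
  then show ?thesis by (simp add: k(1))
qed

end

section \<open>Transfer of the real-valued results to the extended real valued model\<close>

theorem proposition7p5:
  fixes M :: "'w measure" and p :: real and \<rho> :: "('w \<Rightarrow> real) \<Rightarrow> ereal"
    and MZ :: "'z measure" and Zs :: "nat \<Rightarrow> 'w \<Rightarrow> 'z" and Z :: "'w \<Rightarrow> 'z"
    and A :: "'a::polish_space set" and D :: "(real \<times> 'a) set"
    and T :: "real \<Rightarrow> 'a \<Rightarrow> 'z \<Rightarrow> real" and c :: "real \<Rightarrow> 'a \<Rightarrow> real \<Rightarrow> real"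
    and \<alpha> \<beta> b_lo \<epsilon>_hi :: real and b_hi b :: "real \<Rightarrow> real"
    and PiM :: "(nat \<Rightarrow> real \<Rightarrow> 'a) set"
    and Td :: "(real \<Rightarrow> 'a) \<Rightarrow> (real \<Rightarrow> ereal) \<Rightarrow> real \<Rightarrow> ereal"
    and TB :: "(real \<Rightarrow> ereal) \<Rightarrow> real \<Rightarrow> ereal"
    and Jpol :: "nat \<Rightarrow> (nat \<Rightarrow> real \<Rightarrow> 'a) \<Rightarrow> real \<Rightarrow> ereal"
    and JN :: "nat \<Rightarrow> real \<Rightarrow> ereal"
    and Jinfpol :: "(nat \<Rightarrow> real \<Rightarrow> 'a) \<Rightarrow> real \<Rightarrow> ereal"
    and Jinf J :: "real \<Rightarrow> ereal"
    and b_lo_inf :: real and b_hi_inf :: "real \<Rightarrow> real" and I :: "(real \<Rightarrow> ereal) set"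
  \<comment> \<open>notation\<close>
  defines "PiM \<equiv> markov_policies A D"
    and "Td \<equiv> policy_op \<rho> T Z c \<beta>"
    and "TB \<equiv> bellman_op \<rho> T Z c \<beta> D"
    and "Jpol \<equiv> policy_value \<rho> T Z c \<beta>"
    and "JN \<equiv> (\<lambda>N x. INF \<pi>\<in>PiM. Jpol N \<pi> x)"
    and "Jinfpol \<equiv> (\<lambda>\<pi> x. lim (\<lambda>N. Jpol N \<pi> x))"
    and "Jinf \<equiv> (\<lambda>x. INF \<pi>\<in>PiM. Jinfpol \<pi> x)"
    and "J \<equiv> (\<lambda>x. lim (\<lambda>N. JN N x))"
    and "b \<equiv> (\<lambda>x. b_hi x - b_lo)"
    and "b_lo_inf \<equiv> 1 / (1 - \<alpha> * \<beta>) * b_lo"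
    and "b_hi_inf \<equiv> (\<lambda>x. 1 / (1 - \<alpha> * \<beta>) * b_hi x)"
    and "I \<equiv> value_classI b_lo_inf b_hi_inf"
  \<comment> \<open>the decision model\<close>
  assumes M: "prob_space M" and p: "1 \<le> p"
    and Z: "Z \<in> M \<rightarrow>\<^sub>M MZ"
    and Zs_indep: "prob_space.indep_vars M (\<lambda>_. MZ) Zs UNIV"
    and Zs_ident: "\<And>n. distr M MZ (Zs n) = distr M MZ Z"
    and A: "A \<in> sets borel"
    and D: "D \<in> sets (borel \<Otimes>\<^sub>M restrict_space borel A)"
    and D_graph: "\<exists>f \<in> borel \<rightarrow>\<^sub>M restrict_space borel A. \<forall>x. (x, f x) \<in> D"
    and T: "(\<lambda>((x, a), z). T x a z)
              \<in> restrict_space (borel \<Otimes>\<^sub>M restrict_space borel A) D \<Otimes>\<^sub>M MZ \<rightarrow>\<^sub>M borel"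
    and \<beta>: "0 < \<beta>" "\<beta> \<le> 1"
    and J_meas: "\<And>\<pi> N. \<pi> \<in> PiM \<Longrightarrow> Jpol N \<pi> \<in> borel_measurable borel"
  \<comment> \<open>(M2)\<close>
    and D_compact: "\<And>x. compact (D `` {x})"
    and D_usc: "\<And>xs x as. xs \<longlonglongrightarrow> x \<Longrightarrow> (\<And>k. as k \<in> D `` {xs k}) \<Longrightarrow>
                  \<exists>a \<in> D `` {x}. \<exists>r. strict_mono (r :: nat \<Rightarrow> nat) \<and> (as \<circ> r) \<longlonglongrightarrow> a"
    and D_decr: "\<And>x y. x \<le> y \<Longrightarrow> D `` {y} \<subseteq> D `` {x}"
  \<comment> \<open>(M3)\<close>
    and T_lsc: "\<And>z. z \<in> space MZ \<Longrightarrow> lsc_on D (\<lambda>(x, a). T x a z)"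
    and T_incr: "\<And>z x y a. z \<in> space MZ \<Longrightarrow> (x, a) \<in> D \<Longrightarrow> (y, a) \<in> D \<Longrightarrow> x \<le> y \<Longrightarrow>
                   T x a z \<le> T y a z"
  \<comment> \<open>(M4)\<close>
    and c_lsc: "lsc_on (D \<times> UNIV) (\<lambda>((x, a), x'). c x a x')"
    and c_incr: "\<And>x y a x' y'. (x, a) \<in> D \<Longrightarrow> (y, a) \<in> D \<Longrightarrow> x \<le> y \<Longrightarrow> x' \<le> y' \<Longrightarrow>
                   c x a x' \<le> c y a y'"
  \<comment> \<open>(B-)\<close>
    and bounds: "b_lo \<le> 0" "0 \<le> \<epsilon>_hi" "1 \<le> \<alpha>" "\<epsilon>_hi - b_lo = 1"
    and b_hi: "mono b_hi" "\<And>x. \<epsilon>_hi \<le> b_hi x"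
    and c_lower: "\<And>x a. (x, a) \<in> D \<Longrightarrow> AE w in M. b_lo \<le> c x a (T x a (Z w))"
    and c_upper: "\<And>x a. (x, a) \<in> D \<Longrightarrow> \<rho> (\<lambda>w. c x a (T x a (Z w))) \<le> ereal (b_hi x)"
    and b_hi_growth: "\<And>x a. (x, a) \<in> D \<Longrightarrow> \<rho> (\<lambda>w. b_hi (T x a (Z w))) \<le> ereal (\<alpha> * b_hi x)"
  \<comment> \<open>integrability\<close>
    and integrability: "\<And>x0 a0. (x0, a0) \<in> D \<Longrightarrow>
          \<exists>\<epsilon>>0. \<exists>\<Theta>1 \<in> borel_measurable MZ. \<exists>\<Theta>2 \<in> borel_measurable MZ.
            (\<forall>z\<in>space MZ. 0 \<le> \<Theta>1 z \<and> 0 \<le> \<Theta>2 z) \<and>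
            (\<lambda>w. \<Theta>1 (Z w)) \<in> Lp_space M p \<and> (\<lambda>w. \<Theta>2 (Z w)) \<in> Lp_space M p \<and>
            (\<forall>z\<in>space MZ. \<forall>(x, a) \<in> D \<inter> cball (x0, a0) \<epsilon>.
               \<bar>c x a (T x a z)\<bar> \<le> \<Theta>1 z \<and> b (T x a z) \<le> \<Theta>2 z)"
  \<comment> \<open>risk measure\<close>
    and rho: "monetary M p \<rho>" "law_invariant M p \<rho>" "comonotonic_additive M p \<rho>"
             "pos_homogeneous M p \<rho>" "fatou_property M p \<rho>"
  \<comment> \<open>discounting\<close>
    and discounting: "\<alpha> * \<beta> < 1"
  shows
    \<comment> \<open>a)\<close>
    "(\<forall>\<pi>\<in>PiM. \<forall>x. (\<forall>N. \<bar>Jpol N \<pi> x\<bar> \<noteq> \<infinity>) \<and> (\<lambda>N. Jpol N \<pi> x) \<longlonglongrightarrow> Jinfpol \<pi> x \<and>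
        ereal b_lo_inf \<le> Jinfpol \<pi> x \<and> Jinfpol \<pi> x \<le> ereal (b_hi_inf x)) \<and>
    \<comment> \<open>b)\<close>
     (0 < \<alpha> * \<beta> \<and> \<alpha> * \<beta> < 1 \<and> (\<forall>v\<in>I. TB v \<in> I) \<and>
      (\<forall>v\<in>I. \<forall>w\<in>I. weighted_norm b (\<lambda>x. TB v x - TB w x)
                       \<le> ereal (\<alpha> * \<beta>) * weighted_norm b (\<lambda>x. v x - w x)) \<and>
      (\<forall>x. (\<lambda>N. JN N x) \<longlonglongrightarrow> J x) \<and> J \<in> I \<and> TB J = J \<and> (\<forall>v\<in>I. TB v = v \<longrightarrow> v = J)) \<and>
    \<comment> \<open>c)\<close>
     ((\<exists>d\<in>decision_rules A D. Td d J = TB J) \<and>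
      (\<forall>d\<in>decision_rules A D. Td d J = TB J \<longrightarrow> Jinfpol (\<lambda>_. d) = Jinf) \<and>
      Jinf = J)"
proof -
  have b_nonneg: "0 \<le> b_hi x" and b_ge_1: "1 \<le> b_hi x - b_lo" for x
    using bounds b_hi(2)[of x] by linarith+
  have D_nonempty: "D `` {x} \<noteq> {}" for x using D_graph by blast
  interpret prob_space M by (rule M)
  interpret risk_mdp M p \<rho> MZ Z A D T c \<alpha> \<beta> b_lo b_hi
    by unfold_locales
      (fact p Z D D_nonempty T \<beta>(1) D_usc D_decr T_lsc T_incr c_lsc c_incr bounds(1,3) b_hi(1)
        b_nonneg b_ge_1 c_lower c_upper b_hi_growth integrability[unfolded b_def] rho(1,3,4,5)
        discounting J_meas[unfolded PiM_def Jpol_def])+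
  let ?V = "\<lambda>x. ereal (value_limit x)"
  have I: "I = (\<lambda>v x. ereal (v x)) ` lsc_values"
    unfolding I_def b_lo_inf_def b_hi_inf_def \<kappa>_def[symmetric] by (rule value_classI_eq)
  have J_lim: "(\<lambda>N. JN N x) \<longlonglongrightarrow> ?V x" for x
    unfolding JN_def Jpol_def PiM_def INF_policy_value using value_limit_tendsto by simp
  have J: "J = ?V"
    unfolding J_def by (intro ext limI J_lim)
  have TB: "TB (\<lambda>x. ereal (v x)) = (\<lambda>x. ereal (bellman v x))" if "v \<in> lsc_values" for v
    unfolding TB_def by (rule bellman_op_eq[OF that])
  have Td: "Td d ?V = (\<lambda>x. ereal (next_risk value_limit x (d x)))" if "d \<in> decision_rules A D" for d
    unfolding Td_def by (rule policy_op_eq[OF value_limit_lsc_values that])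
  have TB_V: "TB ?V = ?V"
    by (simp add: TB[OF value_limit_lsc_values] bellman_value_limit)
  have Jinfpol: "Jinfpol \<pi> x = ereal (policy_limit \<pi> x)" if "\<pi> \<in> PiM" for \<pi> x
    unfolding Jinfpol_def Jpol_def using that lim_policy_value(2) unfolding PiM_def by blast
  have stationary: "(\<lambda>_. d) \<in> PiM \<and> Jinfpol (\<lambda>_. d) = ?V"
    if d: "d \<in> decision_rules A D" "Td d J = TB J" for d
  proof -
    have mem: "(\<lambda>_. d) \<in> PiM" using d(1) by (simp add: PiM_def markov_policies_def)
    \<comment> \<open>\<open>Td d J = TB J\<close> becomes the greedy equation because the Bellman
      operator fixes \<open>J\<close>.\<close>
    have "next_risk value_limit x (d x) = value_limit x" for x
      using fun_cong[OF d(2), of x] by (simp add: J Td[OF d(1)] TB_V)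
    from stationary_optimal[OF d(1) this] show ?thesis
      using mem by (auto simp: Jinfpol[OF mem])
  qed
  obtain d where d: "d \<in> decision_rules A D" "\<And>x. bellman value_limit x = next_risk value_limit x (d x)"
    using bellman_attained[OF value_limit_lsc_values] by blast
  have greedy: "Td d J = TB J"
    by (simp add: J Td[OF d(1)] TB[OF value_limit_lsc_values] d(2))
  \<comment> \<open>The greedy stationary policy attains \<open>J\<close>, and \<open>J\<close>
    bounds the limit of every policy from below.\<close>
  have Jinf: "Jinf = J"
  proof
    fix x
    have "Jinf x \<le> Jinfpol (\<lambda>_. d) x"
      unfolding Jinf_def using stationary[OF d(1) greedy] by (intro INF_lower) simp
    also have "\<dots> = J x" using stationary[OF d(1) greedy] by (simp add: J)
    finally have "Jinf x \<le> J x" .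
    moreover have "J x \<le> Jinf x"
      unfolding Jinf_def using value_limit_le_policy_limit
      by (intro INF_greatest) (simp add: J Jinfpol, simp add: PiM_def)
    ultimately show "Jinf x = J x" by (rule antisym)
  qed
  have a: "\<forall>\<pi>\<in>PiM. \<forall>x. (\<forall>N. \<bar>Jpol N \<pi> x\<bar> \<noteq> \<infinity>) \<and> (\<lambda>N. Jpol N \<pi> x) \<longlonglongrightarrow> Jinfpol \<pi> x \<and>
      ereal b_lo_inf \<le> Jinfpol \<pi> x \<and> Jinfpol \<pi> x \<le> ereal (b_hi_inf x)"
    using policy_return(2) lim_policy_value(1) policy_limit_bounds
    by (simp add: Jinfpol) (simp add: PiM_def Jpol_def b_lo_inf_def b_hi_inf_def \<kappa>_def[symmetric])
  have b1: "\<forall>v\<in>I. TB v \<in> I"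
    unfolding I using bellman_lsc_values by (auto simp: TB)
  have b2: "\<forall>v\<in>I. \<forall>w\<in>I. weighted_norm b (\<lambda>x. TB v x - TB w x)
      \<le> ereal (\<alpha> * \<beta>) * weighted_norm b (\<lambda>x. v x - w x)"
    unfolding I b_def using bellman_contraction by (simp add: TB)
  have b3: "J \<in> I" unfolding I J using value_limit_lsc_values by blast
  have b4: "\<forall>v\<in>I. TB v = v \<longrightarrow> v = J"
  proof (intro ballI impI)
    fix v assume "v \<in> I" "TB v = v"
    then obtain u where u: "u \<in> lsc_values" "v = (\<lambda>x. ereal (u x))" and "bellman u = u"
      by (auto simp: I TB fun_eq_iff)
    then show "v = J" using bellman_fixed_point_unique by (simp add: J)
  qed
  have b5: "\<forall>x. (\<lambda>N. JN N x) \<longlonglongrightarrow> J x" and b6: "TB J = J"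
    using J_lim TB_V by (simp_all add: J)
  have c1: "\<exists>d\<in>decision_rules A D. Td d J = TB J" using d(1) greedy by blast
  have c2: "\<forall>d\<in>decision_rules A D. Td d J = TB J \<longrightarrow> Jinfpol (\<lambda>_. d) = Jinf"
    using stationary by (simp add: Jinf) (simp add: J)
  show ?thesis
    by (intro conjI) (fact a modulus(1) discounting b1 b2 b3 b4 b5 b6 c1 c2 Jinf)+
qed

end
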